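(* Fix an integer $m\ge 2$, and let $\rho=\rho_n\in[0,1)$ be a sequence of correlations satisfying $$\rho^2\;\ge\;\frac{8}{m}\cdot\frac{\log n}{n-1}.$$ Then there exists a threshold $\tau$ (a real number that may depend on $n,m,\rho$) such that the test that rejects the null hypothesis if and only if $T(X)\ge\tau$ achieves strong detection, i.e. $$\mathsf P(T(X)<\tau)+\mathsf Q(T(X)\ge\tau)=o(1)\qquad\text{as } n\to\infty .$$
   Context: Let $[n]=\{1,\dots,n\}$, let $\mathcal E_n=\binom{[n]}{2}$ be the set of unordered pairs of distinct elements of $[n]$, and $N=|\mathcal E_n|=\binom n2$. The integer $m\ge2$ is independent of $n$. The data are $X=(X^k_e)_{1\le k\le m,\,e\in\mathcal E_n}\in\mathbb R^{mN}$. Let $\mathfrak S_n$ be the set of permutations of $[n]$; a permutation $\tau\in\mathfrak S_n$ acts on edges by $\tau(\{i,j\})=\{\tau(i),\tau(j)\}$. Null law $\mathsf Q$: all $mN$ coordinates of $X$ are independent standard Gaussians. Planted law $\mathsf P$: there is a latent tuple $\pi^*=(\pi_1^*,\dots,\pi_m^* )$ with $\pi^*_1=\mathrm{Id}$ and $\pi_2^*,\dots,\pi_m^*$ i.i.d. uniform on $\mathfrak S_n$; conditionally on $\pi^*$, the vectors $(X^1_{\pi_1^*(e)},\dots,X^m_{\pi_m^*(e)})$, $e\in\mathcal E_n$, are independent centered Gaussian vectors with common covariance matrix $(1-\rho)I_m+\rho\mathbf 1\mathbf 1^\top$. Test statistic: for $\pi=(\pi_1,\dots,\pi_m)$ with $\pi_1=\mathrm{Id}$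 and $\pi_2,\dots,\pi_m\in\mathfrak S_n$, $$T_\pi(X)=\sum_{e\in\mathcal E_n}\sum_{1\le k<\ell\le m}X^k_{\pi_k(e)}X^\ell_{\pi_\ell(e)},\qquad T(X)=\max_{\pi_2,\dots,\pi_m\in\mathfrak S_n}T_\pi(X).$$ *)

theory Defs
  imports "HOL-Probability.Probability" "HOL-Combinatorics.Permutations"
begin

definition edges :: "nat \<Rightarrow> nat set set" where
  "edges n = {e. e \<subseteq> {1..n} \<and> card e = 2}"

definition perms :: "nat \<Rightarrow> (nat \<Rightarrow> nat) set" where
  "perms n = {p. p permutes {1..n}}"

text \<open>The coordinate \<open>X\<^sup>k\<^sub>e\<close> of the data is \<open>X (k, e)\<close>.  A permutation \<open>p\<close> acts on an edge \<open>e\<close> by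
  the image \<open>p ` e\<close>.\<close>

definition data_index :: "nat \<Rightarrow> nat \<Rightarrow> (nat \<times> nat set) set" where
  "data_index n m = {1..m} \<times> edges n"

definition null_law :: "nat \<Rightarrow> nat \<Rightarrow> (nat \<times> nat set \<Rightarrow> real) measure" where
  "null_law n m = PiM (data_index n m) (\<lambda>_. density lborel std_normal_density)"

text \<open>\<open>\<sigma>\<close> is the standard deviation; \<open>\<sigma> = 0\<close> gives the degenerate Gaussian.\<close>

definition normal_law :: "real \<Rightarrow> real \<Rightarrow> real measure" where
  "normal_law \<mu> \<sigma> = (if \<sigma> = 0 then return borel \<mu> else density lborel (normal_density \<mu> \<sigma>))"

text \<open>A random vector is Gaussian iff all linear combinations of its coordinates are (possibly
  degenerate) Gaussian variables.  All coordinates are then square integrable, so the moments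
  below are genuine.\<close>

definition is_centered_gaussian :: "'i set \<Rightarrow> ('i \<Rightarrow> 'i \<Rightarrow> real) \<Rightarrow> ('i \<Rightarrow> real) measure \<Rightarrow> bool" where
  "is_centered_gaussian I \<Sigma> G \<longleftrightarrow>
     prob_space G \<and>
     sets G = sets (PiM I (\<lambda>_. borel)) \<and>
     (\<forall>a. \<exists>\<mu> \<sigma>. 0 \<le> \<sigma> \<and> distr G borel (\<lambda>x. \<Sum>i\<in>I. a i * x i) = normal_law \<mu> \<sigma>) \<and>
     (\<forall>i\<in>I. (\<integral>x. x i \<partial>G) = 0) \<and>
     (\<forall>i\<in>I. \<forall>j\<in>I. (\<integral>x. x i * x j \<partial>G) = \<Sigma> i j)"

text \<open>For finite \<open>I\<close> the mean and the covariance matrix determine a Gaussian law (Cramer--Wold), so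
  the choice below does not matter when \<open>\<Sigma>\<close> is positive semidefinite.\<close>

definition centered_gaussian_law :: "'i set \<Rightarrow> ('i \<Rightarrow> 'i \<Rightarrow> real) \<Rightarrow> ('i \<Rightarrow> real) measure" where
  "centered_gaussian_law I \<Sigma> = (SOME G. is_centered_gaussian I \<Sigma> G)"

text \<open>The entries of \<open>(1 - \<rho>) I + \<rho> 1 1\<^sup>T\<close>.\<close>

definition equicorrelation :: "real \<Rightarrow> nat \<Rightarrow> nat \<Rightarrow> real" where
  "equicorrelation \<rho> k l = (1 - \<rho>) * (if k = l then 1 else 0) + \<rho>"

text \<open>The conditional law of the data given the latent tuple \<open>\<pi>\<close>: with independent Gaussian vectors
  \<open>V e\<close> for the edges \<open>e\<close>, the data are given by \<open>X (k, \<pi> k ` e) = V e k\<close>.\<close>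

definition planted_law_given ::
    "nat \<Rightarrow> nat \<Rightarrow> real \<Rightarrow> (nat \<Rightarrow> nat \<Rightarrow> nat) \<Rightarrow> (nat \<times> nat set \<Rightarrow> real) measure" where
  "planted_law_given n m \<rho> \<pi> =
     distr (PiM (edges n) (\<lambda>_. centered_gaussian_law {1..m} (equicorrelation \<rho>)))
       (PiM (data_index n m) (\<lambda>_. borel))
       (\<lambda>V. \<lambda>(k, f)\<in>data_index n m. V (inv (\<pi> k) ` f) k)"

text \<open>The components of the latent tuple with index in \<open>{2..m}\<close> are i.i.d. uniform; all others, in
  particular the first, are the default value \<open>id\<close>.\<close>

definition latent_pmf :: "nat \<Rightarrow> nat \<Rightarrow> (nat \<Rightarrow> nat \<Rightarrow> nat) pmf" where
  "latent_pmf n m = Pi_pmf {2..m} id (\<lambda>_. pmf_of_set (perms n))"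

definition planted_law :: "nat \<Rightarrow> nat \<Rightarrow> real \<Rightarrow> (nat \<times> nat set \<Rightarrow> real) measure" where
  "planted_law n m \<rho> = measure_pmf (latent_pmf n m) \<bind> planted_law_given n m \<rho>"

definition T_at :: "nat \<Rightarrow> nat \<Rightarrow> (nat \<Rightarrow> nat \<Rightarrow> nat) \<Rightarrow> (nat \<times> nat set \<Rightarrow> real) \<Rightarrow> real" where
  "T_at n m \<pi> X =
     (\<Sum>e\<in>edges n. \<Sum>k\<in>{1..m}. \<Sum>l\<in>{k<..m}. X (k, \<pi> k ` e) * X (l, \<pi> l ` e))"

text \<open>The maximum ranges over the tuples with components in \<open>perms n\<close> at the indices \<open>{2..m}\<close> and
  \<open>id\<close> elsewhere.\<close>

definition T_max :: "nat \<Rightarrow> nat \<Rightarrow> (nat \<times> nat set \<Rightarrow> real) \<Rightarrow> real" where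
  "T_max n m X = (MAX \<pi>\<in>PiE_dflt {2..m} id (\<lambda>_. perms n). T_at n m \<pi> X)"

end

theory Submission
  imports Defs "HOL-Real_Asymp.Real_Asymp"
begin

text \<open>The threshold is placed slightly below the planted mean.  Write \<open>N\<close> for the number of edges and
\<open>q(v)\<close> for the sum of the products \<open>v\<^sub>k v\<^sub>l\<close> over \<open>k < l \<le> m\<close>, so that \<open>T\<close> at a tuple \<open>\<pi>\<close> is a sum
of \<open>N\<close> values of \<open>q\<close>.  At the latent tuple these are independent copies of \<open>q(V)\<close> with \<open>V\<close>
equicorrelated Gaussian, whose mean is \<open>\<rho> m (m - 1) / 2\<close>.  The threshold is
\<open>\<tau> = N \<rho> m (m - 1) / 2 - t\<close> with \<open>t = n powr (5/4)\<close>.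

Under the planted law, \<open>T_max\<close> is at least its value at the latent tuple, and \<open>q(V)\<close> has a second
moment bounded in terms of \<open>m\<close> alone, since each coordinate of \<open>V\<close> is standard normal.
Chebyshev's inequality bounds the probability of falling below \<open>\<tau>\<close> by a multiple of \<open>N / t\<^sup>2\<close>
(lemma \<open>T_max_planted_lower_deviation\<close>), which tends to \<open>0\<close> because \<open>t\<close> is of larger order than
the standard deviation, which is at most of order \<open>n\<close>.

Under the null law, a union bound over the \<open>fact n ^ (m - 1)\<close> tuples is combined with Chernoff's
bound (lemma \<open>T_max_null_upper_tail\<close>).  The moment generating function of \<open>q\<close> at a standard
Gaussian vector is \<open>(1 + \<theta>) powr (- (m - 1) / 2) * (1 - (m - 1) * \<theta>) powr (- 1 / 2)\<close>, and its
logarithm is \<open>m (m - 1) \<theta>\<^sup>2 / 4\<close> up to a cubic error.  Take for \<open>\<theta>\<close> the smallest admissible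
correlation \<open>r\<close>, given by \<open>r\<^sup>2 = 8 / m * (ln n / (n - 1))\<close>.  Then \<open>N r\<^sup>2 m (m - 1) / 4\<close> equals exactly
\<open>(m - 1) n ln n\<close>, so in the exponent the Chernoff gain, at least \<open>2 (m - 1) n ln n - r t\<close>, cancels
both the quadratic term of the logarithm and the leading term of the entropy
\<open>(m - 1) ln (fact n) \<le> (m - 1) (n ln n - n + ln n + 1)\<close>.  What remains is \<open>- (m - 1) n\<close>, supplied
by the second term of Stirling's formula.  It dominates the two errors: \<open>r t\<close> is of order
\<open>n powr (3/4) * sqrt (ln n)\<close>, and the cubic error \<open>N r ^ 3\<close> is of order
\<open>sqrt n * ln n powr (3/2)\<close>.\<close>

section \<open>Gaussian integrals and linear combinations\<close>

text \<open>Completing the square turns the integrand times the standard density into a constant multiple of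
the normal density with mean \<open>b / (1 - c)\<close> and variance \<open>1 / (1 - c)\<close>.\<close>

lemma nn_integral_exp_quadratic_std_normal:
  fixes b c :: real
  assumes "c < 1"
  shows "(\<integral>\<^sup>+x. ennreal (exp (b * x + c * x\<^sup>2 / 2)) \<partial>density lborel std_normal_density)
    = ennreal ((1 - c) powr (- 1 / 2) * exp (b\<^sup>2 / (2 * (1 - c))))"
proof -
  define K where "K = (1 - c) powr (- 1 / 2) * exp (b\<^sup>2 / (2 * (1 - c)))"
  define \<mu> \<sigma> where "\<mu> = b / (1 - c)" and "\<sigma> = 1 / sqrt (1 - c)"
  have pos: "1 - c > 0" using assms by simp
  have sq: "sqrt (1 - c) > 0" using pos by simp
  have s2: "\<sigma>\<^sup>2 = 1 / (1 - c)" using pos by (simp add: \<sigma>_def power_divide)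
  have K: "(1 - c) powr (- 1 / 2) = 1 / sqrt (1 - c)"
    using pos by (simp add: powr_minus_divide powr_half_sqrt)
  have eq: "std_normal_density x * exp (b * x + c * x\<^sup>2 / 2) = K * normal_density \<mu> \<sigma> x" for x
  proof -
    have e: "- x\<^sup>2 / 2 + (b * x + c * x\<^sup>2 / 2) = b\<^sup>2 / (2 * (1 - c)) + - (x - \<mu>)\<^sup>2 / (2 * \<sigma>\<^sup>2)"
    proof -
      obtain d where d: "c = 1 - d" "d \<noteq> 0" using pos by (intro that[of "1 - c"]) auto
      show ?thesis
        using d(2) unfolding s2 \<mu>_def d(1) by (simp add: field_simps power2_eq_square)
    qed
    have s: "sqrt (2 * pi * \<sigma>\<^sup>2) = sqrt (2 * pi) / sqrt (1 - c)"
      by (simp add: s2 real_sqrt_divide real_sqrt_mult)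
    then have "std_normal_density x * exp (b * x + c * x\<^sup>2 / 2)
        = 1 / sqrt (2 * pi) * exp (- x\<^sup>2 / 2 + (b * x + c * x\<^sup>2 / 2))"
      by (simp add: normal_density_def exp_add[symmetric])
    also have "\<dots> = K * (1 / (sqrt (2 * pi) / sqrt (1 - c)) * exp (- (x - \<mu>)\<^sup>2 / (2 * \<sigma>\<^sup>2)))"
      unfolding e exp_add K_def K using sq by simp
    also have "\<dots> = K * normal_density \<mu> \<sigma> x"
      unfolding normal_density_def s by simp
    finally show ?thesis .
  qed
  have "(\<integral>\<^sup>+x. ennreal (exp (b * x + c * x\<^sup>2 / 2)) \<partial>density lborel std_normal_density)
      = (\<integral>\<^sup>+x. ennreal K * ennreal (normal_density \<mu> \<sigma> x) \<partial>lborel)"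
    by (subst nn_integral_density)
       (auto simp: ennreal_mult'[symmetric] eq K_def intro!: nn_integral_cong)
  also have "\<dots> = ennreal K * (\<integral>\<^sup>+x. ennreal (normal_density \<mu> \<sigma> x) \<partial>lborel)"
    by (rule nn_integral_cmult) simp
  also have "(\<integral>\<^sup>+x. ennreal (normal_density \<mu> \<sigma> x) \<partial>lborel) = 1"
    by (subst nn_integral_eq_integral) (use pos in \<open>auto simp: \<sigma>_def\<close>)
  finally show ?thesis by (simp add: K_def)
qed

text \<open>Independent normals add up to a normal variable.  The coordinates with coefficient \<open>0\<close> are removed
first, since they have no density after scaling; if none is left, the law is the degenerate one.\<close>

lemma distr_linear_combination_std_normal:
  assumes fin: "finite I"
  shows "distr (PiM I (\<lambda>_. density lborel std_normal_density)) borel (\<lambda>x. \<Sum>i\<in>I. b i * x i)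
    = normal_law 0 (sqrt (\<Sum>i\<in>I. (b i)\<^sup>2))"
proof -
  let ?N = "density lborel std_normal_density"
  let ?M = "PiM I (\<lambda>_. ?N)"
  interpret N: prob_space ?N by (rule prob_space_normal_density) simp
  interpret P: prob_space ?M by (rule prob_space_PiM) (rule N.prob_space_axioms)
  define J where "J = {i\<in>I. b i \<noteq> 0}"
  have J: "J \<subseteq> I" "finite J" using fin by (auto simp: J_def)
  have sumJ: "(\<Sum>i\<in>I. b i * x i) = (\<Sum>i\<in>J. b i * x i)" for x
    by (rule sum.mono_neutral_right) (use fin in \<open>auto simp: J_def\<close>)
  have sumJ2: "(\<Sum>i\<in>I. (b i)\<^sup>2) = (\<Sum>i\<in>J. (b i)\<^sup>2)"
    by (rule sum.mono_neutral_right) (use fin in \<open>auto simp: J_def\<close>)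
  show ?thesis
  proof (cases "J = {}")
    case True
    then have "distr ?M borel (\<lambda>x. \<Sum>i\<in>I. b i * x i) = distr ?M borel (\<lambda>_. 0)"
      by (simp add: sumJ)
    also have "\<dots> = return borel 0" by (rule P.distr_const) simp
    finally show ?thesis by (simp add: sumJ2 True normal_law_def)
  next
    case False
    have comp: "distr ?M ?N (\<lambda>x. x i) = ?N" if "i \<in> I" for i
      by (rule distr_PiM_component) (use that fin in \<open>auto intro: N.prob_space_axioms\<close>)
    have "I \<noteq> {}" using False J by auto
    have indepN: "P.indep_vars (\<lambda>_. ?N) (\<lambda>i x. x i) I"
    proof (subst P.indep_vars_iff_distr_eq_PiM'[OF \<open>I \<noteq> {}\<close>])
      have "distr ?M ?M (\<lambda>x. restrict (\<lambda>i. x i) I) = distr ?M ?M (\<lambda>x. x)"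
        by (rule distr_cong) (auto simp: space_PiM PiE_def extensional_restrict)
      also have "\<dots> = ?M" by (rule distr_id2) simp
      also have "\<dots> = PiM I (\<lambda>i. distr ?M ?N (\<lambda>x. x i))"
        by (rule PiM_cong) (simp_all add: comp)
      finally show "distr ?M (PiM I (\<lambda>i. ?N)) (\<lambda>x. \<lambda>i\<in>I. x i)
          = PiM I (\<lambda>i. distr ?M ?N (\<lambda>x. x i))" .
    qed simp
    have indep: "P.indep_vars (\<lambda>_. borel) (\<lambda>i x. b i * x i) J"
      by (rule P.indep_vars_compose2[OF P.indep_vars_subset[OF indepN J(1)], where Y="\<lambda>i x. b i * x"])
         simp
    have "distributed ?M lborel (\<lambda>x. \<Sum>i\<in>J. b i * x i)
        (normal_density (\<Sum>i\<in>J. 0) (sqrt (\<Sum>i\<in>J. \<bar>b i\<bar>\<^sup>2)))"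
    proof (rule P.sum_indep_normal[OF J(2) False indep])
      fix i assume i: "i \<in> J"
      then show "0 < \<bar>b i\<bar>" by (simp add: J_def)
      have "distr ?M lborel (\<lambda>x. x i) = distr ?M ?N (\<lambda>x. x i)"
        by (rule distr_cong) auto
      also have "\<dots> = ?N" using comp i J by auto
      finally have "distributed ?M lborel (\<lambda>x. x i) std_normal_density"
        using i J unfolding distributed_def by auto
      from P.normal_density_affine[OF this, of "b i" 0] i
      show "distributed ?M lborel (\<lambda>x. b i * x i) (normal_density 0 \<bar>b i\<bar>)"
        by (simp add: J_def)
    qed
    then have d: "distr ?M lborel (\<lambda>x. \<Sum>i\<in>J. b i * x i)
        = density lborel (normal_density 0 (sqrt (\<Sum>i\<in>J. (b i)\<^sup>2)))"
      by (simp add: distributed_def)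
    have "(\<Sum>i\<in>J. (b i)\<^sup>2) > 0"
      by (rule sum_pos) (use J False in \<open>auto simp: J_def\<close>)
    then have "sqrt (\<Sum>i\<in>J. (b i)\<^sup>2) \<noteq> 0" by simp
    moreover have "distr ?M borel (\<lambda>x. \<Sum>i\<in>J. b i * x i) = distr ?M lborel (\<lambda>x. \<Sum>i\<in>J. b i * x i)"
      by (rule distr_cong) auto
    ultimately show ?thesis by (simp add: sumJ sumJ2 normal_law_def d)
  qed
qed

section \<open>Gaussian vectors with a given covariance matrix\<close>

lemma normal_law_centered_moments:
  assumes "0 \<le> \<sigma>"
  shows "integrable (normal_law 0 \<sigma>) (\<lambda>x. x)" "(\<integral>x. x \<partial>normal_law 0 \<sigma>) = 0"
    "integrable (normal_law 0 \<sigma>) (\<lambda>x. x\<^sup>2)" "(\<integral>x. x\<^sup>2 \<partial>normal_law 0 \<sigma>) = \<sigma>\<^sup>2"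
proof -
  consider "\<sigma> = 0" | "\<sigma> > 0" using assms by linarith
  then have "integrable (normal_law 0 \<sigma>) (\<lambda>x. x) \<and> (\<integral>x. x \<partial>normal_law 0 \<sigma>) = 0 \<and>
    integrable (normal_law 0 \<sigma>) (\<lambda>x. x\<^sup>2) \<and> (\<integral>x. x\<^sup>2 \<partial>normal_law 0 \<sigma>) = \<sigma>\<^sup>2"
  proof cases
    case 1
    then show ?thesis
      by (simp add: normal_law_def integral_return integrableI_bounded nn_integral_return)
  next
    case 2
    have "integrable (normal_law 0 \<sigma>) (\<lambda>x. x)" "(\<integral>x. x \<partial>normal_law 0 \<sigma>) = 0"
      using 2 integrable_normal_moment_nz_1[OF 2, of 0] integral_normal_moment_nz_1[OF 2, of 0]
      by (auto simp: normal_law_def integrable_density integral_density)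
    moreover have "integrable (normal_law 0 \<sigma>) (\<lambda>x. x\<^sup>2)" "(\<integral>x. x\<^sup>2 \<partial>normal_law 0 \<sigma>) = \<sigma>\<^sup>2"
      using 2 integrable_normal_moment[OF 2, of 0 2] integral_normal_moment_even[OF 2, of 0 1]
      by (auto simp: normal_law_def integrable_density integral_density)
    ultimately show ?thesis by simp
  qed
  then show "integrable (normal_law 0 \<sigma>) (\<lambda>x. x)" "(\<integral>x. x \<partial>normal_law 0 \<sigma>) = 0"
    "integrable (normal_law 0 \<sigma>) (\<lambda>x. x\<^sup>2)" "(\<integral>x. x\<^sup>2 \<partial>normal_law 0 \<sigma>) = \<sigma>\<^sup>2"
    by auto
qed

text \<open>A covariance matrix that factors as \<open>B B\<^sup>T\<close> is realised by applying \<open>B\<close> to a vector of independent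
standard normals.\<close>

lemma is_centered_gaussian_linear_image:
  fixes B :: "'i \<Rightarrow> 'j \<Rightarrow> real"
  assumes J: "finite J"
  shows "is_centered_gaussian I (\<lambda>i j. \<Sum>k\<in>J. B i k * B j k)
    (distr (PiM J (\<lambda>_. density lborel std_normal_density)) (PiM I (\<lambda>_. borel))
      (\<lambda>z. \<lambda>i\<in>I. \<Sum>k\<in>J. B i k * z k))"
proof -
  let ?N = "density lborel std_normal_density"
  let ?M = "PiM J (\<lambda>_. ?N)"
  let ?Y = "\<lambda>z. \<lambda>i\<in>I. \<Sum>k\<in>J. B i k * z k"
  let ?G = "distr ?M (PiM I (\<lambda>_. borel)) ?Y"
  interpret N: prob_space ?N by (rule prob_space_normal_density) simp
  interpret P: prob_space ?M by (rule prob_space_PiM) (rule N.prob_space_axioms)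
  have coord [measurable]: "(\<lambda>z. z k) \<in> borel_measurable ?M" if "k \<in> J" for k
    using measurable_component_singleton[OF that, of "\<lambda>_. ?N"] by simp
  have lin [measurable]: "(\<lambda>z. \<Sum>k\<in>J. b k * z k) \<in> borel_measurable ?M" for b :: "'j \<Rightarrow> real"
    by (intro borel_measurable_sum) auto
  have Y [measurable]: "?Y \<in> measurable ?M (PiM I (\<lambda>_. borel))"
    by (intro measurable_restrict lin)
  have comb: "distr ?M borel (\<lambda>z. \<Sum>k\<in>J. b k * z k) = normal_law 0 (sqrt (\<Sum>k\<in>J. (b k)\<^sup>2))" for b
    by (rule distr_linear_combination_std_normal[OF J])
  have int1: "integrable ?M (\<lambda>z. \<Sum>k\<in>J. b k * z k)"
    and E1: "(\<integral>z. (\<Sum>k\<in>J. b k * z k) \<partial>?M) = 0"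
    and int2: "integrable ?M (\<lambda>z. (\<Sum>k\<in>J. b k * z k)\<^sup>2)"
    and E2: "(\<integral>z. (\<Sum>k\<in>J. b k * z k)\<^sup>2 \<partial>?M) = (\<Sum>k\<in>J. (b k)\<^sup>2)" for b
  proof -
    have s: "0 \<le> sqrt (\<Sum>k\<in>J. (b k)\<^sup>2)" "0 \<le> (\<Sum>k\<in>J. (b k)\<^sup>2)" by (auto intro: sum_nonneg)
    note mom = normal_law_centered_moments[OF s(1), folded comb]
    show "integrable ?M (\<lambda>z. \<Sum>k\<in>J. b k * z k)"
      using mom(1) by (simp add: integrable_distr_eq)
    show "(\<integral>z. (\<Sum>k\<in>J. b k * z k) \<partial>?M) = 0"
      using mom(2) by (simp add: integral_distr)
    show "integrable ?M (\<lambda>z. (\<Sum>k\<in>J. b k * z k)\<^sup>2)"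
      using mom(3) by (simp add: integrable_distr_eq)
    show "(\<integral>z. (\<Sum>k\<in>J. b k * z k)\<^sup>2 \<partial>?M) = (\<Sum>k\<in>J. (b k)\<^sup>2)"
      using mom(4) s(2) by (simp add: integral_distr)
  qed
  \<comment> \<open>Covariances follow from the variances of linear combinations by polarisation.\<close>
  have E12: "(\<integral>z. (\<Sum>k\<in>J. b k * z k) * (\<Sum>k\<in>J. c k * z k) \<partial>?M) = (\<Sum>k\<in>J. b k * c k)" for b c
  proof -
    have pol: "(\<Sum>k\<in>J. b k * z k) * (\<Sum>k\<in>J. c k * z k) =
      ((\<Sum>k\<in>J. (b k + c k) * z k)\<^sup>2 - (\<Sum>k\<in>J. b k * z k)\<^sup>2 - (\<Sum>k\<in>J. c k * z k)\<^sup>2) / 2" for z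
      by (simp add: distrib_right sum.distrib power2_sum)
    have "(\<integral>z. (\<Sum>k\<in>J. b k * z k) * (\<Sum>k\<in>J. c k * z k) \<partial>?M)
      = ((\<Sum>k\<in>J. (b k + c k)\<^sup>2) - (\<Sum>k\<in>J. (b k)\<^sup>2) - (\<Sum>k\<in>J. (c k)\<^sup>2)) / 2"
      unfolding pol
      by (simp add: int2 E2[of b] E2[of c] E2[of "\<lambda>k. b k + c k"])
    also have "\<dots> = (\<Sum>k\<in>J. b k * c k)"
      by (simp add: power2_sum sum.distrib sum_distrib_left mult_ac)
    finally show ?thesis .
  qed
  have "\<exists>\<mu> \<sigma>. 0 \<le> \<sigma> \<and> distr ?G borel (\<lambda>x. \<Sum>i\<in>I. a i * x i) = normal_law \<mu> \<sigma>" for a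
  proof (intro exI conjI)
    have "distr ?G borel (\<lambda>x. \<Sum>i\<in>I. a i * x i)
        = distr ?M borel (\<lambda>z. \<Sum>k\<in>J. (\<Sum>i\<in>I. a i * B i k) * z k)"
    proof (subst distr_distr)
      show "distr ?M borel ((\<lambda>x. \<Sum>i\<in>I. a i * x i) \<circ> ?Y)
          = distr ?M borel (\<lambda>z. \<Sum>k\<in>J. (\<Sum>i\<in>I. a i * B i k) * z k)"
      proof (rule distr_cong)
        fix z
        have "((\<lambda>x. \<Sum>i\<in>I. a i * x i) \<circ> ?Y) z = (\<Sum>i\<in>I. \<Sum>k\<in>J. a i * B i k * z k)"
          by (simp add: sum_distrib_left mult.assoc)
        also have "\<dots> = (\<Sum>k\<in>J. (\<Sum>i\<in>I. a i * B i k) * z k)"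
          by (subst sum.swap) (simp add: sum_distrib_right)
        finally show "((\<lambda>x. \<Sum>i\<in>I. a i * x i) \<circ> ?Y) z = (\<Sum>k\<in>J. (\<Sum>i\<in>I. a i * B i k) * z k)" .
      qed auto
    qed (auto intro!: borel_measurable_sum)
    then show "distr ?G borel (\<lambda>x. \<Sum>i\<in>I. a i * x i)
        = normal_law 0 (sqrt (\<Sum>k\<in>J. (\<Sum>i\<in>I. a i * B i k)\<^sup>2))"
      by (simp only: comb)
  qed (auto intro: sum_nonneg)
  moreover have "(\<integral>x. x i \<partial>?G) = 0" if "i \<in> I" for i
    by (subst integral_distr) (use that in \<open>auto simp: E1\<close>)
  moreover have "(\<integral>x. x i * x j \<partial>?G) = (\<Sum>k\<in>J. B i k * B j k)" if "i \<in> I" "j \<in> I" for i j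
    by (subst integral_distr) (use that in \<open>auto simp: E12\<close>)
  moreover have "prob_space ?G" by (rule P.prob_space_distr) (rule Y)
  ultimately show ?thesis
    unfolding is_centered_gaussian_def by auto
qed

text \<open>The choice operator yields a Gaussian law with this covariance only if there is one.  The law of the
vector with coordinates \<open>sqrt \<rho> * z\<^sub>0 + sqrt (1 - \<rho>) * z\<^sub>k\<close>, in which all coordinates
share the standard normal \<open>z\<^sub>0\<close>, is one.\<close>

lemma is_centered_gaussian_equicorrelation:
  assumes "0 \<le> \<rho>" "\<rho> \<le> 1"
  shows "is_centered_gaussian {1..m} (equicorrelation \<rho>)
    (centered_gaussian_law {1..m} (equicorrelation \<rho>))"
proof -
  define B :: "nat \<Rightarrow> nat \<Rightarrow> real"
    where "B i k = (if k = 0 then sqrt \<rho> else if k = i then sqrt (1 - \<rho>) else 0)" for i k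
  have cov: "(\<Sum>k\<in>{0..m}. B i k * B j k) = equicorrelation \<rho> i j" if "i \<in> {1..m}" for i j
  proof -
    have "(\<Sum>k\<in>{0..m}. B i k * B j k) = B i 0 * B j 0 + (\<Sum>k\<in>{1..m}. B i k * B j k)"
      by (simp add: sum.atLeast_Suc_atMost)
    also have "(\<Sum>k\<in>{1..m}. B i k * B j k) = (\<Sum>k\<in>{1..m}. if k = i then (1 - \<rho>) * (if i = j then 1 else 0) else 0)"
      by (rule sum.cong) (use assms in \<open>auto simp: B_def\<close>)
    also have "\<dots> = (1 - \<rho>) * (if i = j then 1 else 0)"
      using that by (simp add: sum.delta)
    finally show ?thesis using assms by (simp add: B_def equicorrelation_def)
  qed
  obtain G where G: "is_centered_gaussian {1..m} (\<lambda>i j. \<Sum>k\<in>{0..m}. B i k * B j k) G"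
    using is_centered_gaussian_linear_image[of "{0..m}" "{1..m}" B] by auto
  then have "is_centered_gaussian {1..m} (equicorrelation \<rho>) G"
    unfolding is_centered_gaussian_def using cov by auto
  then show ?thesis
    unfolding centered_gaussian_law_def by (rule someI)
qed

text \<open>A coordinate is a linear combination of all of them, hence normal, and its first two moments fix its
parameters.\<close>

lemma centered_gaussian_standard_marginal:
  assumes G: "is_centered_gaussian I \<Sigma> G" and I: "finite I" "i \<in> I" and var: "\<Sigma> i i = 1"
  shows "distr G borel (\<lambda>x. x i) = density lborel std_normal_density"
proof -
  have sets: "sets G = sets (PiM I (\<lambda>_. borel))" using G by (simp add: is_centered_gaussian_def)
  have m [measurable]: "(\<lambda>x. x i) \<in> borel_measurable G"
    by (subst measurable_cong_sets[OF sets refl]) (use I in simp)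
  have "\<exists>\<mu> \<sigma>. 0 \<le> \<sigma> \<and> distr G borel (\<lambda>x. \<Sum>j\<in>I. (if j = i then 1 else 0) * x j) = normal_law \<mu> \<sigma>"
    using G unfolding is_centered_gaussian_def by simp
  moreover have "(\<Sum>j\<in>I. (if j = i then 1 else 0) * x j) = x i" for x :: "'a \<Rightarrow> real"
    using I by (simp add: if_distrib[of "\<lambda>t. t * _"] sum.delta' cong: if_cong)
  ultimately obtain \<mu> \<sigma> where \<sigma>: "0 \<le> \<sigma>" and d: "distr G borel (\<lambda>x. x i) = normal_law \<mu> \<sigma>"
    by auto
  have "(\<integral>y. y \<partial>normal_law \<mu> \<sigma>) = \<mu>"
  proof (cases "\<sigma> = 0")
    case False
    then have "\<sigma> > 0" using \<sigma> by simp
    from integral_normal_moment_nz_1[OF this, of \<mu>] False show ?thesis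
      by (simp add: normal_law_def integral_density)
  qed (simp add: normal_law_def integral_return)
  moreover have "(\<integral>y. y \<partial>normal_law \<mu> \<sigma>) = (\<integral>x. x i \<partial>G)"
    unfolding d[symmetric] by (simp add: integral_distr)
  moreover have "(\<integral>x. x i \<partial>G) = 0" using G I unfolding is_centered_gaussian_def by blast
  ultimately have \<mu>: "\<mu> = 0" by simp
  have "(\<integral>y. y\<^sup>2 \<partial>normal_law \<mu> \<sigma>) = (\<integral>x. x i * x i \<partial>G)"
    unfolding d[symmetric] by (simp add: integral_distr power2_eq_square)
  also have "\<dots> = 1" using G I var unfolding is_centered_gaussian_def by metis
  finally have "\<sigma>\<^sup>2 = 1" using normal_law_centered_moments(4)[OF \<sigma>] \<mu> by simp
  then have "\<sigma> = 1" using \<sigma> by (simp add: power2_eq_1_iff)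
  then show ?thesis using d \<mu> by (simp add: normal_law_def)
qed

section \<open>The pairwise product sum\<close>

definition pair_sum :: "nat \<Rightarrow> (nat \<Rightarrow> real) \<Rightarrow> real" where
  "pair_sum m v = (\<Sum>k\<in>{1..m}. \<Sum>l\<in>{k<..m}. v k * v l)"

lemma pair_sum_eq_squares:
  "pair_sum m v = ((\<Sum>k\<in>{1..m}. v k)\<^sup>2 - (\<Sum>k\<in>{1..m}. (v k)\<^sup>2)) / 2"
proof (induction m)
  case (Suc m)
  have ins: "{k<..Suc m} = insert (Suc m) {k<..m}" if "k \<in> {1..m}" for k using that by auto
  have "pair_sum (Suc m) v = (\<Sum>k\<in>{1..m}. \<Sum>l\<in>{k<..Suc m}. v k * v l)"
    by (simp add: pair_sum_def)
  also have "\<dots> = (\<Sum>k\<in>{1..m}. v k * v (Suc m) + (\<Sum>l\<in>{k<..m}. v k * v l))"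
    by (rule sum.cong) (simp_all add: ins)
  also have "\<dots> = (\<Sum>k\<in>{1..m}. v k) * v (Suc m) + pair_sum m v"
    by (simp add: sum.distrib pair_sum_def sum_distrib_right)
  finally show ?case by (simp add: Suc power2_sum field_simps)
qed (simp add: pair_sum_def)

text \<open>By Cauchy--Schwarz the square of the sum is between \<open>0\<close> and \<open>m\<close> times the sum of squares, so the
pairwise product sum is at most \<open>m / 2\<close> times the sum of squares in absolute value.  Fourth powers
are what the marginals control.\<close>

lemma pair_sum_power2_le: "(pair_sum m v)\<^sup>2 \<le> real m ^ 3 / 4 * (\<Sum>k\<in>{1..m}. v k ^ 4)"
proof -
  let ?S = "\<Sum>k\<in>{1..m}. v k" and ?Q = "\<Sum>k\<in>{1..m}. (v k)\<^sup>2"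
  have Q: "0 \<le> ?Q" by (intro sum_nonneg) auto
  have SQ: "?S\<^sup>2 \<le> real m * ?Q"
    using sum_squared_le_sum_of_squares[of v "{1..m}"] by (simp add: mult.commute)
  have Q2: "?Q\<^sup>2 \<le> real m * (\<Sum>k\<in>{1..m}. v k ^ 4)"
    using sum_squared_le_sum_of_squares[of "\<lambda>k. (v k)\<^sup>2" "{1..m}"]
    by (simp add: mult.commute power_mult[symmetric])
  have mQ: "?Q \<le> real m * ?Q"
  proof (cases "m = 0")
    case False
    then show ?thesis using Q by (simp add: mult_le_cancel_right1)
  qed simp
  have "\<bar>(s - q) / 2\<bar> \<le> M / 2" if "0 \<le> s" "s \<le> M" "0 \<le> q" "q \<le> M" for s q M :: real
    using that by (simp add: abs_le_iff)
  from this[OF zero_le_power2 SQ Q mQ] have "\<bar>pair_sum m v\<bar> \<le> real m / 2 * ?Q"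
    by (simp add: pair_sum_eq_squares)
  then have "\<bar>pair_sum m v\<bar>\<^sup>2 \<le> (real m / 2 * ?Q)\<^sup>2"
    by (rule power_mono) simp
  also have "\<dots> = (real m)\<^sup>2 / 4 * ?Q\<^sup>2" by (simp add: power_mult_distrib power_divide)
  also have "\<dots> \<le> (real m)\<^sup>2 / 4 * (real m * (\<Sum>k\<in>{1..m}. v k ^ 4))"
    by (intro mult_left_mono Q2) simp
  also have "\<dots> = real m ^ 3 / 4 * (\<Sum>k\<in>{1..m}. v k ^ 4)"
    by (simp add: power2_eq_square power3_eq_cube)
  finally show ?thesis by simp
qed

lemma equicorrelated_gaussian_pair_sum:
  assumes G: "is_centered_gaussian {1..m} (equicorrelation \<rho>) G"
  shows "pair_sum m \<in> borel_measurable G"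
    and "(\<integral>v. pair_sum m v \<partial>G) = \<rho> * (real m * (real m - 1) / 2)"
    and "integrable G (\<lambda>v. (pair_sum m v)\<^sup>2)"
    and "(\<integral>v. (pair_sum m v)\<^sup>2 \<partial>G) \<le> 3 * real m ^ 4 / 4"
proof -
  interpret prob_space G using G by (simp add: is_centered_gaussian_def)
  have sets: "sets G = sets (PiM {1..m} (\<lambda>_. borel))"
    using G by (simp add: is_centered_gaussian_def)
  have coord [measurable]: "(\<lambda>v. v k) \<in> borel_measurable G" if "k \<in> {1..m}" for k
    by (subst measurable_cong_sets[OF sets refl]) (use that in simp)
  have std: "distr G borel (\<lambda>v. v k) = density lborel std_normal_density" if "k \<in> {1..m}" for k
    using centered_gaussian_standard_marginal[OF G _ that] by (simp add: equicorrelation_def)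
  have i4: "integrable G (\<lambda>v. v k ^ 4)" and e4: "(\<integral>v. v k ^ 4 \<partial>G) = 3"
    if k: "k \<in> {1..m}" for k
  proof -
    have "integrable (density lborel std_normal_density) (\<lambda>x. x ^ 4 :: real)"
      using integrable_std_normal_moment[of 4] by (simp add: integrable_density)
    then show "integrable G (\<lambda>v. v k ^ 4)"
      unfolding std[OF k, symmetric] using k by (simp add: integrable_distr_eq)
    have "(\<integral>x. x ^ 4 \<partial>density lborel std_normal_density) = (3::real)"
      using integral_std_normal_moment_even[of 2] by (simp add: integral_density fact_numeral)
    then show "(\<integral>v. v k ^ 4 \<partial>G) = 3"
      unfolding std[OF k, symmetric] using k by (simp add: integral_distr)
  qed
  have i2: "integrable G (\<lambda>v. (v k)\<^sup>2)" if k: "k \<in> {1..m}" for k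
  proof -
    have "integrable (density lborel std_normal_density) (\<lambda>x. x\<^sup>2 :: real)"
      using integrable_std_normal_moment[of 2] by (simp add: integrable_density)
    then show ?thesis
      unfolding std[OF k, symmetric] using k by (simp add: integrable_distr_eq)
  qed
  have i11: "integrable G (\<lambda>v. v k * v l)" if "k \<in> {1..m}" "l \<in> {1..m}" for k l
  proof (rule Bochner_Integration.integrable_bound)
    show "integrable G (\<lambda>v. (v k)\<^sup>2 + (v l)\<^sup>2)" using that i2 by simp
    show "AE v in G. norm (v k * v l) \<le> norm ((v k)\<^sup>2 + (v l)\<^sup>2)"
    proof (rule AE_I2)
      fix v :: "nat \<Rightarrow> real"
      have "2 * (\<bar>v k\<bar> * \<bar>v l\<bar>) \<le> \<bar>v k\<bar>\<^sup>2 + \<bar>v l\<bar>\<^sup>2"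
        using sum_squares_bound[of "\<bar>v k\<bar>" "\<bar>v l\<bar>"] by (simp add: mult.assoc)
      moreover have "0 \<le> \<bar>v k\<bar> * \<bar>v l\<bar>" by simp
      ultimately have "\<bar>v k\<bar> * \<bar>v l\<bar> \<le> (v k)\<^sup>2 + (v l)\<^sup>2" by (simp only: power2_abs)
      then show "norm (v k * v l) \<le> norm ((v k)\<^sup>2 + (v l)\<^sup>2)" by (simp add: abs_mult)
    qed
  qed (use that in measurable)
  show meas [measurable]: "pair_sum m \<in> borel_measurable G"
    unfolding pair_sum_eq_squares by (intro borel_measurable_divide borel_measurable_diff
      borel_measurable_power borel_measurable_sum coord borel_measurable_const)
  have "(\<integral>v. pair_sum m v \<partial>G) = (\<Sum>k\<in>{1..m}. \<Sum>l\<in>{k<..m}. \<integral>v. v k * v l \<partial>G)"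
    unfolding pair_sum_def
    by (subst Bochner_Integration.integral_sum,
        auto intro!: Bochner_Integration.integrable_sum i11 sum.cong Bochner_Integration.integral_sum)
  also have "\<dots> = (\<Sum>k\<in>{1..m}. \<Sum>l\<in>{k<..m}. \<rho> * (1 * 1))"
    by (intro sum.cong refl) (use G in \<open>auto simp: is_centered_gaussian_def equicorrelation_def\<close>)
  also have "\<dots> = \<rho> * pair_sum m (\<lambda>_. 1)"
    unfolding pair_sum_def by (simp only: sum_distrib_left)
  also have "\<dots> = \<rho> * (real m * (real m - 1) / 2)"
    unfolding pair_sum_eq_squares by (simp add: power2_eq_square algebra_simps)
  finally show "(\<integral>v. pair_sum m v \<partial>G) = \<rho> * (real m * (real m - 1) / 2)" .
  have ibd: "integrable G (\<lambda>v. real m ^ 3 / 4 * (\<Sum>k\<in>{1..m}. v k ^ 4))"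
    by (intro Bochner_Integration.integrable_mult_right Bochner_Integration.integrable_sum i4)
  show i: "integrable G (\<lambda>v. (pair_sum m v)\<^sup>2)"
  proof (rule Bochner_Integration.integrable_bound[OF ibd])
    show "AE v in G. norm ((pair_sum m v)\<^sup>2) \<le> norm (real m ^ 3 / 4 * (\<Sum>k\<in>{1..m}. v k ^ 4))"
      using pair_sum_power2_le[of m] by (intro AE_I2) (simp add: order_trans[OF _ abs_ge_self])
  qed measurable
  have "(\<integral>v. (pair_sum m v)\<^sup>2 \<partial>G) \<le> (\<integral>v. real m ^ 3 / 4 * (\<Sum>k\<in>{1..m}. v k ^ 4) \<partial>G)"
    by (intro integral_mono i ibd pair_sum_power2_le)
  also have "\<dots> = real m ^ 3 / 4 * (\<Sum>k\<in>{1..m}. (\<integral>v. v k ^ 4 \<partial>G))"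
    by (simp add: Bochner_Integration.integral_sum i4)
  also have "\<dots> = real m ^ 3 / 4 * (\<Sum>k\<in>{1..m}. 3)"
    by (intro arg_cong2[where f="(*)"] sum.cong refl e4)
  also have "\<dots> = 3 * real m ^ 4 / 4"
    by (simp add: power3_eq_cube power4_eq_xxxx)
  finally show "(\<integral>v. (pair_sum m v)\<^sup>2 \<partial>G) \<le> 3 * real m ^ 4 / 4" .
qed

text \<open>Chebyshev's inequality for a sum of i.i.d. variables, with the variance bounded by the second moment.\<close>

lemma iid_sum_lower_deviation:
  fixes h :: "'a \<Rightarrow> real"
  assumes G: "prob_space G" and fin: "finite E" and h [measurable]: "h \<in> borel_measurable G"
    and h2: "integrable G (\<lambda>x. (h x)\<^sup>2)" and t: "0 < t"
  shows "measure (PiM E (\<lambda>_. G)) {V \<in> space (PiM E (\<lambda>_. G)).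
      (\<Sum>e\<in>E. h (V e)) < real (card E) * (\<integral>x. h x \<partial>G) - t}
    \<le> real (card E) * (\<integral>x. (h x)\<^sup>2 \<partial>G) / t\<^sup>2"
proof -
  let ?M = "PiM E (\<lambda>_. G)"
  interpret G: prob_space G by (rule G)
  interpret P: prob_space ?M by (rule prob_space_PiM) (rule G)
  interpret prod: product_sigma_finite "\<lambda>_. G" by standard
  define \<mu> where "\<mu> = (\<integral>x. h x \<partial>G)"
  define w where "w x = h x - \<mu>" for x
  have h1: "integrable G h" using h h2 by (rule G.square_integrable_imp_integrable)
  have w [measurable]: "w \<in> borel_measurable G" unfolding w_def by measurable
  have iw: "integrable G w" using h1 unfolding w_def by simp
  have Ew: "(\<integral>x. w x \<partial>G) = 0" using h1 unfolding w_def by (simp add: \<mu>_def G.prob_space)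
  have w2: "(w x)\<^sup>2 = (h x)\<^sup>2 - 2 * \<mu> * h x + \<mu>\<^sup>2" for x by (simp add: w_def power2_diff)
  have iw2: "integrable G (\<lambda>x. (w x)\<^sup>2)" unfolding w2 using h1 h2 by simp
  have Ew2: "(\<integral>x. (w x)\<^sup>2 \<partial>G) \<le> (\<integral>x. (h x)\<^sup>2 \<partial>G)"
    unfolding w2 using h1 h2 by (simp add: \<mu>_def[symmetric] G.prob_space power2_eq_square)
  have cm [measurable]: "(\<lambda>V. V e) \<in> measurable ?M G" if "e \<in> E" for e
    using that by measurable
  have comp: "distr ?M G (\<lambda>V. V e) = G" if "e \<in> E" for e
    by (rule distr_PiM_component) (use that G in auto)
  have ii: "integrable ?M (\<lambda>V. (w (V e))\<^sup>2)" and E2: "(\<integral>V. (w (V e))\<^sup>2 \<partial>?M) = (\<integral>x. (w x)\<^sup>2 \<partial>G)"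
    if e: "e \<in> E" for e
  proof -
    show "integrable ?M (\<lambda>V. (w (V e))\<^sup>2)"
      using integrable_distr_eq[of "\<lambda>V. V e" ?M G "\<lambda>x. (w x)\<^sup>2"] comp[OF e] cm[OF e] iw2 by simp
    show "(\<integral>V. (w (V e))\<^sup>2 \<partial>?M) = (\<integral>x. (w x)\<^sup>2 \<partial>G)"
      using integral_distr[of "\<lambda>V. V e" ?M G "\<lambda>x. (w x)\<^sup>2"] comp[OF e] cm[OF e] by simp
  qed
  have ij: "integrable ?M (\<lambda>V. w (V e) * w (V f))"
    and E0: "(\<integral>V. w (V e) * w (V f) \<partial>?M) = 0"
    if e: "e \<in> E" and f: "f \<in> E" and ef: "e \<noteq> f" for e f
  proof -
    \<comment> \<open>The cross term as a product over all of \<open>E\<close>, for which the product measure factorises.\<close>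
    define g where "g i = (if i = e \<or> i = f then w else (\<lambda>_. 1))" for i
    have ig: "integrable G (g i)" for i using iw by (simp add: g_def)
    have pr: "w (V e) * w (V f) = (\<Prod>i\<in>E. g i (V i))" for V
    proof -
      have "(\<Prod>i\<in>E. g i (V i)) = (\<Prod>i\<in>{e, f}. g i (V i))"
        by (rule prod.mono_neutral_right) (use fin e f in \<open>auto simp: g_def\<close>)
      then show ?thesis using ef by (simp add: g_def)
    qed
    show "integrable ?M (\<lambda>V. w (V e) * w (V f))"
      unfolding pr by (rule prod.product_integrable_prod[OF fin ig])
    have "(\<Prod>i\<in>E. \<integral>x. g i x \<partial>G) = 0"
      using fin e by (auto simp: prod_zero_iff g_def Ew intro!: bexI[of _ e])
    then show "(\<integral>V. w (V e) * w (V f) \<partial>?M) = 0"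
      unfolding pr by (subst prod.product_integral_prod[OF fin ig])
  qed
  have ie: "integrable ?M (\<lambda>V. w (V e) * w (V f))" if "e \<in> E" "f \<in> E" for e f
    using ij[OF that] ii[OF that(1)] by (cases "e = f") (auto simp: power2_eq_square)
  have sq: "(\<Sum>e\<in>E. w (V e))\<^sup>2 = (\<Sum>e\<in>E. \<Sum>f\<in>E. w (V e) * w (V f))" for V
    by (simp add: power2_eq_square sum_product)
  have isq: "integrable ?M (\<lambda>V. (\<Sum>e\<in>E. w (V e))\<^sup>2)"
    unfolding sq by (intro Bochner_Integration.integrable_sum ie)
  have "(\<integral>V. (\<Sum>e\<in>E. w (V e))\<^sup>2 \<partial>?M) = (\<Sum>e\<in>E. \<Sum>f\<in>E. \<integral>V. w (V e) * w (V f) \<partial>?M)"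
    unfolding sq
    by (subst Bochner_Integration.integral_sum,
        auto intro!: Bochner_Integration.integrable_sum ie sum.cong Bochner_Integration.integral_sum)
  also have "\<dots> = (\<Sum>e\<in>E. \<Sum>f\<in>E. if f = e then (\<integral>x. (w x)\<^sup>2 \<partial>G) else 0)"
    by (intro sum.cong refl) (use E0 E2 in \<open>auto simp: power2_eq_square\<close>)
  also have "\<dots> = real (card E) * (\<integral>x. (w x)\<^sup>2 \<partial>G)"
    using fin by (simp add: sum.delta)
  finally have var: "(\<integral>V. (\<Sum>e\<in>E. w (V e))\<^sup>2 \<partial>?M) = real (card E) * (\<integral>x. (w x)\<^sup>2 \<partial>G)" .
  have ms [measurable]: "(\<lambda>V. \<Sum>e\<in>E. w (V e)) \<in> borel_measurable ?M"
    by (intro borel_measurable_sum measurable_compose[OF cm w])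
  have shift: "(\<Sum>e\<in>E. w (V e)) = (\<Sum>e\<in>E. h (V e)) - real (card E) * \<mu>" for V
    by (simp add: w_def sum_subtractf)
  have "measure ?M {V \<in> space ?M. (\<Sum>e\<in>E. h (V e)) < real (card E) * \<mu> - t}
      \<le> measure ?M {V \<in> space ?M. t \<le> \<bar>\<Sum>e\<in>E. w (V e)\<bar>}"
    by (rule P.finite_measure_mono) (auto simp: shift)
  also have "\<dots> \<le> (\<integral>V. (\<Sum>e\<in>E. w (V e))\<^sup>2 \<partial>?M) / t\<^sup>2"
    by (rule P.second_moment_method[OF ms isq t])
  also have "\<dots> \<le> real (card E) * (\<integral>x. (h x)\<^sup>2 \<partial>G) / t\<^sup>2"
    unfolding var by (intro divide_right_mono mult_left_mono Ew2) auto
  finally show ?thesis by (simp add: \<mu>_def)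
qed

section \<open>Edges and latent tuples\<close>

lemma finite_edges [simp]: "finite (edges n)"
  unfolding edges_def by (rule finite_subset[of _ "Pow {1..n}"]) auto

lemma card_edges: "real (card (edges n)) = real n * (real n - 1) / 2"
proof -
  have "card (edges n) = n choose 2"
    using n_subsets[of "{1..n}" 2] by (simp add: edges_def)
  moreover have "real (n * (n - 1) div 2) = real (n * (n - 1)) / 2"
    by (subst real_of_nat_div) auto
  ultimately show ?thesis
    by (cases n) (simp_all add: choose_two algebra_simps)
qed

lemma image_edges: "p permutes {1..n} \<Longrightarrow> e \<in> edges n \<Longrightarrow> p ` e \<in> edges n"
  using permutes_image[of p "{1..n}"] permutes_inj[of p "{1..n}"]
  by (auto simp: edges_def card_image inj_on_subset[OF _ subset_UNIV] permutes_in_image subset_eq)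

lemma finite_data_index [simp]: "finite (data_index n m)"
  by (simp add: data_index_def)

text \<open>These are both the tuples that the maximum in \<open>T_max\<close> ranges over and the support of the latent law.\<close>

definition latent_tuples :: "nat \<Rightarrow> nat \<Rightarrow> (nat \<Rightarrow> nat \<Rightarrow> nat) set" where
  "latent_tuples n m = PiE_dflt {2..m} id (\<lambda>_. perms n)"

lemma finite_perms [simp]: "finite (perms n)"
  by (simp add: perms_def finite_permutations)

lemma perms_nonempty: "perms n \<noteq> {}"
  using permutes_id[of "{1..n}"] unfolding perms_def by blast

lemma finite_latent_tuples [simp]: "finite (latent_tuples n m)"
  unfolding latent_tuples_def by (rule finite_PiE_dflt) auto

lemma card_latent_tuples: "card (latent_tuples n m) = fact n ^ (m - 1)"
  unfolding latent_tuples_def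
  by (subst card_PiE_dflt) (auto simp: perms_def card_permutations finite_permutations)

lemma latent_tuples_nonempty: "latent_tuples n m \<noteq> {}"
proof -
  have "(\<lambda>_. id) \<in> latent_tuples n m"
    by (auto simp: latent_tuples_def PiE_dflt_def perms_def permutes_id)
  then show ?thesis by auto
qed

lemma latent_tuples_permutes: "\<pi> \<in> latent_tuples n m \<Longrightarrow> \<pi> k permutes {1..n}"
  by (cases "k \<in> {2..m}") (auto simp: latent_tuples_def PiE_dflt_def perms_def permutes_id)

lemma set_pmf_latent: "set_pmf (latent_pmf n m) = latent_tuples n m"
  unfolding latent_pmf_def latent_tuples_def
  by (subst set_Pi_pmf) (auto simp: PiE_dflt_def perms_nonempty)

lemma T_at_eq_pair_sum: "T_at n m \<pi> X = (\<Sum>e\<in>edges n. pair_sum m (\<lambda>k. X (k, \<pi> k ` e)))"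
  by (simp add: T_at_def pair_sum_def)

lemma T_max_ge_iff: "\<tau> \<le> T_max n m X \<longleftrightarrow> (\<exists>\<pi>\<in>latent_tuples n m. \<tau> \<le> T_at n m \<pi> X)"
  unfolding T_max_def using finite_latent_tuples[of n m] latent_tuples_nonempty[of n m]
  by (subst Max_ge_iff) (auto simp: latent_tuples_def)

lemma borel_measurable_T_at:
  assumes "\<pi> \<in> latent_tuples n m"
  shows "T_at n m \<pi> \<in> borel_measurable (PiM (data_index n m) (\<lambda>_. borel))"
proof -
  have "(k, \<pi> k ` e) \<in> data_index n m" if "k \<in> {1..m}" "e \<in> edges n" for k e
    using that image_edges[OF latent_tuples_permutes[OF assms]] by (auto simp: data_index_def)
  then show ?thesis
    unfolding T_at_def by (intro borel_measurable_sum borel_measurable_times measurable_component_singleton) auto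
qed

lemma sets_T_max_ge:
  "{X \<in> space (PiM (data_index n m) (\<lambda>_. borel)). \<tau> \<le> T_max n m X}
    \<in> sets (PiM (data_index n m) (\<lambda>_. borel))"
proof -
  have "{X \<in> space (PiM (data_index n m) (\<lambda>_. borel)). \<tau> \<le> T_max n m X} =
    (\<Union>\<pi>\<in>latent_tuples n m. {X \<in> space (PiM (data_index n m) (\<lambda>_. borel)). \<tau> \<le> T_at n m \<pi> X})"
    by (auto simp: T_max_ge_iff)
  then show ?thesis
    using borel_measurable_T_at by (auto intro!: sets.finite_UN borel_measurable_le)
qed

lemma sets_T_max_less:
  "{X \<in> space (PiM (data_index n m) (\<lambda>_. borel)). T_max n m X < \<tau>}
    \<in> sets (PiM (data_index n m) (\<lambda>_. borel))"
proof -
  have "{X \<in> space (PiM (data_index n m) (\<lambda>_. borel)). T_max n m X < \<tau>} =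
    space (PiM (data_index n m) (\<lambda>_. borel)) -
    {X \<in> space (PiM (data_index n m) (\<lambda>_. borel)). \<tau> \<le> T_max n m X}"
    by auto
  then show ?thesis using sets_T_max_ge by auto
qed

section \<open>The planted law\<close>

text \<open>For components of \<open>\<pi>\<close> that are not permutations the index \<open>inv (\<pi> k) ` f\<close> may fail to be an edge.
The coordinate is then the constant \<open>undefined k\<close>, by extensionality of the points of the product
space.  This case is covered because the bind over the latent law needs a kernel at every \<open>\<pi>\<close>, not
only on the support.\<close>

lemma measurable_planted_data:
  assumes "sets G = sets (PiM {1..m} (\<lambda>_. borel))"
  shows "(\<lambda>V. \<lambda>(k, f)\<in>data_index n m. V (inv (\<pi> k) ` f) k)
    \<in> measurable (PiM (edges n) (\<lambda>_. G)) (PiM (data_index n m) (\<lambda>_. borel :: real measure))"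
proof (rule measurable_restrict, clarify)
  fix k f assume "(k, f) \<in> data_index n m"
  then have k: "k \<in> {1..m}" by (simp add: data_index_def)
  show "(\<lambda>V. V (inv (\<pi> k) ` f) k) \<in> borel_measurable (PiM (edges n) (\<lambda>_. G))"
  proof (cases "inv (\<pi> k) ` f \<in> edges n")
    case True
    have "(\<lambda>v. v k) \<in> borel_measurable G"
      by (subst measurable_cong_sets[OF assms refl]) (use k in simp)
    then show ?thesis
      by (rule measurable_compose[OF measurable_component_singleton[OF True]])
  next
    case False
    have "(\<lambda>V. undefined k) \<in> borel_measurable (PiM (edges n) (\<lambda>_. G))" by simp
    then show ?thesis
      by (rule measurable_cong[THEN iffD1, rotated])
         (use False in \<open>auto simp: space_PiM PiE_def extensional_def\<close>)
  qed
qed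

lemma prob_space_planted_law_given:
  assumes "0 \<le> \<rho>" "\<rho> \<le> 1"
  shows "prob_space (planted_law_given n m \<rho> \<pi>)"
proof -
  note G = is_centered_gaussian_equicorrelation[OF assms, of m]
  have "prob_space (PiM (edges n) (\<lambda>_. centered_gaussian_law {1..m} (equicorrelation \<rho>)))"
    by (rule prob_space_PiM) (use G in \<open>simp add: is_centered_gaussian_def\<close>)
  then show ?thesis
    unfolding planted_law_given_def
    by (rule prob_space.prob_space_distr[OF _ measurable_planted_data])
       (use G in \<open>simp add: is_centered_gaussian_def\<close>)
qed

text \<open>At the latent tuple the relabelling of the edges cancels, so \<open>T_at\<close> becomes a sum over the edges of
independent copies of one variable, and \<open>T_max\<close> is at least this sum.\<close>

lemma T_max_planted_given_lower_deviation:
  assumes \<rho>: "0 \<le> \<rho>" "\<rho> \<le> 1" and \<pi>: "\<pi> \<in> latent_tuples n m" and t: "0 < t"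
  shows "measure (planted_law_given n m \<rho> \<pi>)
      {X \<in> space (PiM (data_index n m) (\<lambda>_. borel)).
        T_max n m X < real (card (edges n)) * (\<rho> * (real m * (real m - 1) / 2)) - t}
    \<le> real (card (edges n)) * (3 * real m ^ 4 / 4) / t\<^sup>2"
proof -
  let ?G = "centered_gaussian_law {1..m} (equicorrelation \<rho>)"
  let ?M = "PiM (edges n) (\<lambda>_. ?G)"
  let ?D = "PiM (data_index n m) (\<lambda>_. borel :: real measure)"
  let ?f = "\<lambda>V. \<lambda>(k, f)\<in>data_index n m. V (inv (\<pi> k) ` f) k"
  let ?\<tau> = "real (card (edges n)) * (\<rho> * (real m * (real m - 1) / 2)) - t"
  note G = is_centered_gaussian_equicorrelation[OF \<rho>, of m]
  have pG: "prob_space ?G" and sG: "sets ?G = sets (PiM {1..m} (\<lambda>_. borel))"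
    using G by (simp_all add: is_centered_gaussian_def)
  note q = equicorrelated_gaussian_pair_sum[OF G]
  interpret P: prob_space ?M by (rule prob_space_PiM) (rule pG)
  note f = measurable_planted_data[OF sG, of \<pi> n]
  have T: "T_at n m \<pi> (?f V) = (\<Sum>e\<in>edges n. pair_sum m (V e))" for V
  proof -
    have "?f V (k, \<pi> k ` e) = V e k" if "k \<in> {1..m}" "e \<in> edges n" for k e
    proof -
      have "inv (\<pi> k) ` \<pi> k ` e = e"
        using permutes_inj[OF latent_tuples_permutes[OF \<pi>]] by (simp add: image_comp)
      then show ?thesis
        using that image_edges[OF latent_tuples_permutes[OF \<pi>]] by (simp add: data_index_def)
    qed
    then show ?thesis unfolding T_at_eq_pair_sum pair_sum_def by (intro sum.cong refl) auto
  qed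
  have "measure (planted_law_given n m \<rho> \<pi>) {X \<in> space ?D. T_max n m X < ?\<tau>}
      = measure ?M (?f -` {X \<in> space ?D. T_max n m X < ?\<tau>} \<inter> space ?M)"
    unfolding planted_law_given_def by (rule measure_distr[OF f sets_T_max_less])
  also have "\<dots> \<le> measure ?M {V \<in> space ?M. (\<Sum>e\<in>edges n. pair_sum m (V e)) < ?\<tau>}"
  proof (rule P.finite_measure_mono)
    have "(\<Sum>e\<in>edges n. pair_sum m (V e)) < ?\<tau>" if "T_max n m (?f V) < ?\<tau>" for V
    proof -
      have "\<not> ?\<tau> \<le> T_at n m \<pi> (?f V)"
        using that \<pi> T_max_ge_iff[of ?\<tau> n m "?f V"] by auto
      then show ?thesis by (simp only: T not_le)
    qed
    then show "?f -` {X \<in> space ?D. T_max n m X < ?\<tau>} \<inter> space ?M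
        \<subseteq> {V \<in> space ?M. (\<Sum>e\<in>edges n. pair_sum m (V e)) < ?\<tau>}"
      by blast
    have "(\<lambda>V. pair_sum m (V e)) \<in> borel_measurable ?M" if "e \<in> edges n" for e
      by (rule measurable_compose[OF measurable_component_singleton[OF that] q(1)])
    then have "(\<lambda>V. \<Sum>e\<in>edges n. pair_sum m (V e)) \<in> borel_measurable ?M"
      by (rule borel_measurable_sum)
    then show "{V \<in> space ?M. (\<Sum>e\<in>edges n. pair_sum m (V e)) < ?\<tau>} \<in> sets ?M"
      by measurable
  qed
  also have "\<dots> \<le> real (card (edges n)) * (\<integral>x. (pair_sum m x)\<^sup>2 \<partial>?G) / t\<^sup>2"
    using iid_sum_lower_deviation[OF pG finite_edges q(1,3) t, of n] by (simp only: q(2))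
  also have "\<dots> \<le> real (card (edges n)) * (3 * real m ^ 4 / 4) / t\<^sup>2"
    by (intro divide_right_mono mult_left_mono q(4)) auto
  finally show ?thesis .
qed

text \<open>The bound given the latent tuple is uniform in the tuple, so it survives averaging.\<close>

lemma T_max_planted_lower_deviation:
  assumes \<rho>: "0 \<le> \<rho>" "\<rho> \<le> 1" and t: "0 < t"
    and \<tau>: "\<tau> = real (card (edges n)) * (\<rho> * (real m * (real m - 1) / 2)) - t"
  shows "measure (planted_law n m \<rho>) {X \<in> space (planted_law n m \<rho>). T_max n m X < \<tau>}
    \<le> real (card (edges n)) * (3 * real m ^ 4 / 4) / t\<^sup>2"
proof -
  let ?D = "PiM (data_index n m) (\<lambda>_. borel :: real measure)"
  let ?A = "{X \<in> space ?D. T_max n m X < \<tau>}"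
  let ?c = "real (card (edges n)) * (3 * real m ^ 4 / 4) / t\<^sup>2"
  have sets: "sets (planted_law_given n m \<rho> \<pi>) = sets ?D" for \<pi>
    by (simp add: planted_law_given_def)
  have kernel: "planted_law_given n m \<rho> \<in> measurable (measure_pmf (latent_pmf n m)) (subprob_algebra ?D)"
    using prob_space_imp_subprob_space[OF prob_space_planted_law_given[OF \<rho>]] sets
    by (auto simp: space_subprob_algebra)
  have sp: "space (planted_law n m \<rho>) = space ?D"
    unfolding planted_law_def by (rule space_bind[OF sets]) auto
  have "emeasure (planted_law n m \<rho>) ?A
      = (\<integral>\<^sup>+\<pi>. emeasure (planted_law_given n m \<rho> \<pi>) ?A \<partial>measure_pmf (latent_pmf n m))"
    unfolding planted_law_def by (rule emeasure_bind[OF _ kernel sets_T_max_less]) simp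
  also have "\<dots> \<le> (\<integral>\<^sup>+\<pi>. ennreal ?c \<partial>measure_pmf (latent_pmf n m))"
  proof (rule nn_integral_mono_AE, rule AE_pmfI)
    fix \<pi> assume "\<pi> \<in> set_pmf (latent_pmf n m)"
    then have "\<pi> \<in> latent_tuples n m" by (simp add: set_pmf_latent)
    from T_max_planted_given_lower_deviation[OF \<rho> this t, folded \<tau>]
    have le: "measure (planted_law_given n m \<rho> \<pi>) ?A \<le> ?c" .
    interpret prob_space "planted_law_given n m \<rho> \<pi>"
      by (rule prob_space_planted_law_given[OF \<rho>])
    show "emeasure (planted_law_given n m \<rho> \<pi>) ?A \<le> ennreal ?c"
      using le by (simp add: emeasure_eq_measure ennreal_leI)
  qed
  also have "\<dots> = ennreal ?c" by simp
  finally show ?thesis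
    unfolding sp measure_def by (rule enn2real_leI[rotated]) simp
qed

section \<open>The null law\<close>

text \<open>The Hubbard--Stratonovich transform: for the sum \<open>S\<close> of the coordinates, \<open>exp (\<theta> * S\<^sup>2 / 2)\<close> is the
expectation of \<open>exp (sqrt \<theta> * S * g)\<close> over a standard normal \<open>g\<close>.  Conditionally on \<open>g\<close> the
coordinates decouple, which replaces the diagonalisation of the quadratic form.\<close>

lemma exp_pair_sum_eq_gaussian_mixture:
  assumes "0 \<le> \<theta>"
  shows "(\<integral>\<^sup>+g. (\<Prod>k\<in>{1..m}. ennreal (exp (sqrt \<theta> * g * v k + (- \<theta>) * (v k)\<^sup>2 / 2)))
      \<partial>density lborel std_normal_density) = ennreal (exp (\<theta> * pair_sum m v))"
proof -
  let ?N = "density lborel std_normal_density"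
  let ?S = "\<Sum>k\<in>{1..m}. v k" and ?Q = "\<Sum>k\<in>{1..m}. (v k)\<^sup>2"
  have "(\<Prod>k\<in>{1..m}. ennreal (exp (sqrt \<theta> * g * v k + (- \<theta>) * (v k)\<^sup>2 / 2)))
      = ennreal (exp (- \<theta> * ?Q / 2)) * ennreal (exp (sqrt \<theta> * ?S * g + 0 * g\<^sup>2 / 2))" for g
  proof -
    have "(\<Prod>k\<in>{1..m}. ennreal (exp (sqrt \<theta> * g * v k + (- \<theta>) * (v k)\<^sup>2 / 2)))
        = ennreal (exp (\<Sum>k\<in>{1..m}. sqrt \<theta> * g * v k + (- \<theta>) * (v k)\<^sup>2 / 2))"
      by (simp add: prod_ennreal exp_sum)
    also have "(\<Sum>k\<in>{1..m}. sqrt \<theta> * g * v k + (- \<theta>) * (v k)\<^sup>2 / 2)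
        = - \<theta> * ?Q / 2 + (sqrt \<theta> * ?S * g + 0 * g\<^sup>2 / 2)"
      by (simp only: sum.distrib sum_distrib_left[symmetric] sum_divide_distrib[symmetric]) simp
    also have "ennreal (exp \<dots>) = ennreal (exp (- \<theta> * ?Q / 2)) * ennreal (exp (sqrt \<theta> * ?S * g + 0 * g\<^sup>2 / 2))"
      unfolding exp_add[of "- \<theta> * ?Q / 2"] by (rule ennreal_mult'') simp
    finally show ?thesis .
  qed
  then have "(\<integral>\<^sup>+g. (\<Prod>k\<in>{1..m}. ennreal (exp (sqrt \<theta> * g * v k + (- \<theta>) * (v k)\<^sup>2 / 2))) \<partial>?N)
      = (\<integral>\<^sup>+g. ennreal (exp (- \<theta> * ?Q / 2)) * ennreal (exp (sqrt \<theta> * ?S * g + 0 * g\<^sup>2 / 2)) \<partial>?N)"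
    by simp
  also have "\<dots> = ennreal (exp (- \<theta> * ?Q / 2)) * ennreal ((1 - 0) powr (- 1 / 2) * exp ((sqrt \<theta> * ?S)\<^sup>2 / (2 * (1 - 0))))"
    by (subst nn_integral_cmult, measurable, subst nn_integral_exp_quadratic_std_normal) auto
  also have "\<dots> = ennreal (exp (- \<theta> * ?Q / 2 + \<theta> * ?S\<^sup>2 / 2))"
    unfolding exp_add using assms by (subst ennreal_mult'') (simp_all add: power_mult_distrib)
  also have "- \<theta> * ?Q / 2 + \<theta> * ?S\<^sup>2 / 2 = \<theta> * pair_sum m v"
    unfolding pair_sum_eq_squares by (simp add: field_simps)
  finally show ?thesis .
qed

lemma bij_betw_image_edges: "p permutes {1..n} \<Longrightarrow> bij_betw ((`) p) (edges n) (edges n)"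
proof (rule bij_betwI[where g="(`) (inv p)"])
  assume p: "p permutes {1..n}"
  show "(`) p \<in> edges n \<rightarrow> edges n" using image_edges[OF p] by auto
  show "(`) (inv p) \<in> edges n \<rightarrow> edges n" using image_edges[OF permutes_inv[OF p]] by auto
  show "inv p ` p ` e = e" "p ` inv p ` e = e" for e
    using permutes_inv_o[OF p] by (simp_all add: image_comp)
qed

lemma prod_data_index_reindex:
  fixes F :: "nat \<Rightarrow> nat set \<Rightarrow> nat set \<Rightarrow> ennreal"
  assumes "\<pi> \<in> latent_tuples n m"
  shows "(\<Prod>(k, f)\<in>data_index n m. F k (inv (\<pi> k) ` f) f)
    = (\<Prod>e\<in>edges n. \<Prod>k\<in>{1..m}. F k e (\<pi> k ` e))"
proof -
  have "(\<Prod>(k, f)\<in>data_index n m. F k (inv (\<pi> k) ` f) f)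
      = (\<Prod>k\<in>{1..m}. \<Prod>f\<in>edges n. F k (inv (\<pi> k) ` f) f)"
    unfolding data_index_def by (rule prod.cartesian_product[symmetric])
  also have "\<dots> = (\<Prod>k\<in>{1..m}. \<Prod>e\<in>edges n. F k e (\<pi> k ` e))"
  proof (rule prod.cong[OF refl])
    fix k
    have p: "\<pi> k permutes {1..n}" by (rule latent_tuples_permutes[OF assms])
    have "(\<Prod>f\<in>edges n. F k (inv (\<pi> k) ` f) f)
        = (\<Prod>e\<in>edges n. F k (inv (\<pi> k) ` \<pi> k ` e) (\<pi> k ` e))"
      by (rule prod.reindex_bij_betw[OF bij_betw_image_edges[OF p], symmetric])
    then show "(\<Prod>f\<in>edges n. F k (inv (\<pi> k) ` f) f) = (\<Prod>e\<in>edges n. F k e (\<pi> k ` e))"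
      using permutes_inv_o[OF p] by (simp add: image_comp)
  qed
  also have "\<dots> = (\<Prod>e\<in>edges n. \<Prod>k\<in>{1..m}. F k e (\<pi> k ` e))"
    by (rule prod.swap)
  finally show ?thesis .
qed

text \<open>The moment generating function of the pairwise product sum of \<open>m\<close> independent standard normals.  Its
factors come from the eigenvalues \<open>(m - 1) / 2\<close> (simple) and \<open>- 1 / 2\<close> (of multiplicity \<open>m - 1\<close>) of the
quadratic form.\<close>

definition pair_sum_mgf :: "nat \<Rightarrow> real \<Rightarrow> real" where
  "pair_sum_mgf m \<theta> = (1 + \<theta>) powr (- (real m - 1) / 2) * (1 - (real m - 1) * \<theta>) powr (- 1 / 2)"

text \<open>Introduce one auxiliary normal \<open>g e\<close> per edge and exchange the integrals.  For fixed \<open>g\<close> the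
integrand is a product over the individual coordinates of \<open>X\<close>, because a latent tuple matches the
pairs \<open>(e, k)\<close> bijectively with the data indices.  Hence the value is the same for every tuple, and
the integral over \<open>g\<close> factorises over the edges.\<close>

lemma null_mgf_T_at:
  assumes \<pi>: "\<pi> \<in> latent_tuples n m" and \<theta>: "0 \<le> \<theta>" "(real m - 1) * \<theta> < 1"
  shows "(\<integral>\<^sup>+X. ennreal (exp (\<theta> * T_at n m \<pi> X)) \<partial>null_law n m)
    = ennreal (pair_sum_mgf m \<theta> ^ card (edges n))"
proof -
  let ?N = "density lborel std_normal_density"
  let ?E = "PiM (edges n) (\<lambda>_. ?N)"
  define \<phi> where "\<phi> g x = ennreal (exp (sqrt \<theta> * g * x + (- \<theta>) * x\<^sup>2 / 2))" for g x
  define \<psi> where "\<psi> g = ennreal ((1 + \<theta>) powr (- 1 / 2) * exp (\<theta> * g\<^sup>2 / (2 * (1 + \<theta>))))" for g :: real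
  interpret N: prob_space ?N by (rule prob_space_normal_density) simp
  interpret prod: product_sigma_finite "\<lambda>_. ?N" by standard
  interpret Q: prob_space "null_law n m"
    unfolding null_law_def by (rule prob_space_PiM) (rule N.prob_space_axioms)
  interpret E: prob_space ?E by (rule prob_space_PiM) (rule N.prob_space_axioms)
  interpret QE: pair_sigma_finite "null_law n m" ?E by standard
  have \<phi>_meas: "(\<lambda>y. \<phi> (a y) (b y)) \<in> borel_measurable M"
    if "a \<in> borel_measurable M" "b \<in> borel_measurable M" for a b and M :: "'x measure"
    using that unfolding \<phi>_def by measurable
  have \<psi>_meas [measurable]: "\<psi> \<in> borel_measurable borel" unfolding \<psi>_def by measurable
  have \<psi>: "(\<integral>\<^sup>+x. \<phi> g x \<partial>?N) = \<psi> g" for g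
    using nn_integral_exp_quadratic_std_normal[of "- \<theta>" "sqrt \<theta> * g"] \<theta>
    by (simp add: \<phi>_def \<psi>_def power_mult_distrib)
  have idx: "(k, \<pi> k ` e) \<in> data_index n m" if "k \<in> {1..m}" "e \<in> edges n" for k e
    using that image_edges[OF latent_tuples_permutes[OF \<pi>]] by (auto simp: data_index_def)

  \<comment> \<open>\<open>\<phi>\<close> is the factor of one coordinate given its auxiliary normal, and \<open>\<psi>\<close> its expectation.\<close>
  have "(\<integral>\<^sup>+X. ennreal (exp (\<theta> * T_at n m \<pi> X)) \<partial>null_law n m)
      = (\<integral>\<^sup>+X. (\<integral>\<^sup>+g. (\<Prod>e\<in>edges n. \<Prod>k\<in>{1..m}. \<phi> (g e) (X (k, \<pi> k ` e))) \<partial>?E) \<partial>null_law n m)"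
  proof (rule nn_integral_cong)
    fix X
    have "ennreal (exp (\<theta> * T_at n m \<pi> X))
        = (\<Prod>e\<in>edges n. ennreal (exp (\<theta> * pair_sum m (\<lambda>k. X (k, \<pi> k ` e)))))"
      by (simp add: T_at_eq_pair_sum sum_distrib_left exp_sum prod_ennreal)
    also have "\<dots> = (\<Prod>e\<in>edges n. \<integral>\<^sup>+g. (\<Prod>k\<in>{1..m}. \<phi> g (X (k, \<pi> k ` e))) \<partial>?N)"
      using exp_pair_sum_eq_gaussian_mixture[OF \<theta>(1)] by (simp add: \<phi>_def)
    also have "\<dots> = (\<integral>\<^sup>+g. (\<Prod>e\<in>edges n. \<Prod>k\<in>{1..m}. \<phi> (g e) (X (k, \<pi> k ` e))) \<partial>?E)"
      by (rule prod.product_nn_integral_prod[symmetric])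
         (auto intro!: borel_measurable_prod_ennreal \<phi>_meas)
    finally show "ennreal (exp (\<theta> * T_at n m \<pi> X))
        = (\<integral>\<^sup>+g. (\<Prod>e\<in>edges n. \<Prod>k\<in>{1..m}. \<phi> (g e) (X (k, \<pi> k ` e))) \<partial>?E)" .
  qed
  also have "\<dots> = (\<integral>\<^sup>+g. (\<integral>\<^sup>+X. (\<Prod>e\<in>edges n. \<Prod>k\<in>{1..m}. \<phi> (g e) (X (k, \<pi> k ` e))) \<partial>null_law n m) \<partial>?E)"
  proof (rule QE.Fubini'[symmetric])
    have "(\<lambda>p. \<phi> (snd p e) (fst p (k, \<pi> k ` e))) \<in> borel_measurable (null_law n m \<Otimes>\<^sub>M ?E)"
      if e: "e \<in> edges n" and k: "k \<in> {1..m}" for e k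
    proof (rule \<phi>_meas)
      have "(\<lambda>g. g e) \<in> borel_measurable ?E"
        using measurable_component_singleton[OF e, of "\<lambda>_. ?N"] by simp
      then show "(\<lambda>p. snd p e) \<in> borel_measurable (null_law n m \<Otimes>\<^sub>M ?E)" by measurable
      have "(\<lambda>X. X (k, \<pi> k ` e)) \<in> borel_measurable (null_law n m)"
        using measurable_component_singleton[OF idx[OF k e], of "\<lambda>_. ?N"]
        by (simp add: null_law_def)
      then show "(\<lambda>p. fst p (k, \<pi> k ` e)) \<in> borel_measurable (null_law n m \<Otimes>\<^sub>M ?E)" by measurable
    qed
    then show "(\<lambda>(X, g). \<Prod>e\<in>edges n. \<Prod>k\<in>{1..m}. \<phi> (g e) (X (k, \<pi> k ` e)))
        \<in> borel_measurable (null_law n m \<Otimes>\<^sub>M ?E)"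
      unfolding case_prod_beta by (intro borel_measurable_prod_ennreal)
  qed
  also have "\<dots> = (\<integral>\<^sup>+g. (\<Prod>e\<in>edges n. \<psi> (g e) ^ m) \<partial>?E)"
  proof (rule nn_integral_cong)
    fix g :: "nat set \<Rightarrow> real"
    have "(\<integral>\<^sup>+X. (\<Prod>e\<in>edges n. \<Prod>k\<in>{1..m}. \<phi> (g e) (X (k, \<pi> k ` e))) \<partial>null_law n m)
        = (\<integral>\<^sup>+X. (\<Prod>i\<in>data_index n m. \<phi> (g (inv (\<pi> (fst i)) ` snd i)) (X i)) \<partial>null_law n m)"
      using prod_data_index_reindex[OF \<pi>, of "\<lambda>k e f. \<phi> (g e) (_ (k, f))"]
      by (simp add: case_prod_beta)
    also have "\<dots> = (\<Prod>i\<in>data_index n m. \<integral>\<^sup>+x. \<phi> (g (inv (\<pi> (fst i)) ` snd i)) x \<partial>?N)"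
      unfolding null_law_def by (rule prod.product_nn_integral_prod) (auto intro!: \<phi>_meas)
    also have "\<dots> = (\<Prod>e\<in>edges n. \<psi> (g e) ^ m)"
      using prod_data_index_reindex[OF \<pi>, of "\<lambda>k e f. \<psi> (g e)"]
      by (simp add: \<psi> case_prod_beta)
    finally show "(\<integral>\<^sup>+X. (\<Prod>e\<in>edges n. \<Prod>k\<in>{1..m}. \<phi> (g e) (X (k, \<pi> k ` e))) \<partial>null_law n m)
        = (\<Prod>e\<in>edges n. \<psi> (g e) ^ m)" .
  qed
  also have "\<dots> = (\<Prod>e\<in>edges n. \<integral>\<^sup>+g. \<psi> g ^ m \<partial>?N)"
    by (rule prod.product_nn_integral_prod) auto
  also have "(\<integral>\<^sup>+g. \<psi> g ^ m \<partial>?N) = ennreal (pair_sum_mgf m \<theta>)"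
  proof -
    have pos: "0 < 1 + \<theta>" "0 < 1 - (real m - 1) * \<theta>" using \<theta> by auto
    have c: "1 - real m * \<theta> / (1 + \<theta>) = (1 - (real m - 1) * \<theta>) / (1 + \<theta>)"
      using pos by (simp add: field_simps)
    have "\<psi> g ^ m = ennreal ((1 + \<theta>) powr (- real m / 2))
        * ennreal (exp (0 * g + (real m * \<theta> / (1 + \<theta>)) * g\<^sup>2 / 2))" for g
    proof -
      have "\<psi> g ^ m = ennreal (((1 + \<theta>) powr (- 1 / 2) * exp (\<theta> * g\<^sup>2 / (2 * (1 + \<theta>)))) ^ m)"
        unfolding \<psi>_def by (rule ennreal_power) simp
      also have "((1 + \<theta>) powr (- 1 / 2) * exp (\<theta> * g\<^sup>2 / (2 * (1 + \<theta>)))) ^ m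
          = (1 + \<theta>) powr (- real m / 2) * exp (0 * g + (real m * \<theta> / (1 + \<theta>)) * g\<^sup>2 / 2)"
        using pos by (simp add: power_mult_distrib powr_power exp_of_nat_mult[symmetric] field_simps)
      finally show ?thesis by (simp add: ennreal_mult'')
    qed
    then have "(\<integral>\<^sup>+g. \<psi> g ^ m \<partial>?N) = ennreal ((1 + \<theta>) powr (- real m / 2))
        * (\<integral>\<^sup>+g. ennreal (exp (0 * g + (real m * \<theta> / (1 + \<theta>)) * g\<^sup>2 / 2)) \<partial>?N)"
      by (simp only:) (rule nn_integral_cmult, measurable)
    also have "\<dots> = ennreal ((1 + \<theta>) powr (- real m / 2))
        * ennreal ((1 - real m * \<theta> / (1 + \<theta>)) powr (- 1 / 2) * exp (0\<^sup>2 / (2 * (1 - real m * \<theta> / (1 + \<theta>)))))"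
      using pos by (subst nn_integral_exp_quadratic_std_normal) (auto simp: field_simps)
    also have "\<dots> = ennreal ((1 + \<theta>) powr (- real m / 2) * (1 - real m * \<theta> / (1 + \<theta>)) powr (- 1 / 2))"
      by (simp add: ennreal_mult'')
    also have "(1 + \<theta>) powr (- real m / 2) * (1 - real m * \<theta> / (1 + \<theta>)) powr (- 1 / 2)
        = pair_sum_mgf m \<theta>"
    proof -
      have "(1 + \<theta>) powr (- real m / 2) * ((1 - (real m - 1) * \<theta>) / (1 + \<theta>)) powr (- 1 / 2)
          = ((1 + \<theta>) powr (- real m / 2) * (1 + \<theta>) powr (1 / 2)) * (1 - (real m - 1) * \<theta>) powr (- 1 / 2)"
        using pos by (simp add: powr_divide powr_minus field_simps)
      also have "(1 + \<theta>) powr (- real m / 2) * (1 + \<theta>) powr (1 / 2) = (1 + \<theta>) powr (- (real m - 1) / 2)"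
        by (simp add: powr_add[symmetric] diff_divide_distrib)
      finally show ?thesis unfolding c pair_sum_mgf_def .
    qed
    finally show ?thesis .
  qed
  also have "(\<Prod>e\<in>edges n. ennreal (pair_sum_mgf m \<theta>)) = ennreal (pair_sum_mgf m \<theta> ^ card (edges n))"
    by (simp add: ennreal_power pair_sum_mgf_def)
  finally show ?thesis .
qed

text \<open>Chernoff's bound for each tuple and the union bound over all of them.\<close>

lemma T_max_null_upper_tail:
  assumes \<theta>: "0 \<le> \<theta>" "(real m - 1) * \<theta> < 1"
  shows "measure (null_law n m) {X \<in> space (null_law n m). \<tau> \<le> T_max n m X}
    \<le> fact n ^ (m - 1) * (exp (- \<theta> * \<tau>) * pair_sum_mgf m \<theta> ^ card (edges n))"
proof -
  let ?Q = "null_law n m"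
  let ?b = "exp (- \<theta> * \<tau>) * pair_sum_mgf m \<theta> ^ card (edges n)"
  interpret Q: prob_space ?Q
    unfolding null_law_def by (rule prob_space_PiM) (rule prob_space_normal_density, simp)
  have sets: "sets ?Q = sets (PiM (data_index n m) (\<lambda>_. borel))"
    unfolding null_law_def by (rule sets_PiM_cong) auto
  have T: "T_at n m \<pi> \<in> borel_measurable ?Q" if "\<pi> \<in> latent_tuples n m" for \<pi>
    using borel_measurable_T_at[OF that] by (subst measurable_cong_sets[OF sets refl])
  have chernoff: "measure ?Q {X \<in> space ?Q. \<tau> \<le> T_at n m \<pi> X} \<le> ?b"
    if \<pi>: "\<pi> \<in> latent_tuples n m" for \<pi>
  proof -
    note T[OF \<pi>, measurable]
    have "emeasure ?Q {X \<in> space ?Q. \<tau> \<le> T_at n m \<pi> X}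
        = (\<integral>\<^sup>+X. indicator {X \<in> space ?Q. \<tau> \<le> T_at n m \<pi> X} X \<partial>?Q)"
      by (rule nn_integral_indicator[symmetric]) measurable
    also have "\<dots> \<le> (\<integral>\<^sup>+X. ennreal (exp (- \<theta> * \<tau>)) * ennreal (exp (\<theta> * T_at n m \<pi> X)) \<partial>?Q)"
    proof (rule nn_integral_mono)
      fix X
      have "1 \<le> exp (- \<theta> * \<tau>) * exp (\<theta> * T_at n m \<pi> X)" if "\<tau> \<le> T_at n m \<pi> X"
        using mult_left_mono[OF that \<theta>(1)] by (simp add: exp_add[symmetric])
      then show "indicator {X \<in> space ?Q. \<tau> \<le> T_at n m \<pi> X} X
          \<le> ennreal (exp (- \<theta> * \<tau>)) * ennreal (exp (\<theta> * T_at n m \<pi> X))"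
        by (auto simp: indicator_def ennreal_mult''[symmetric] simp flip: ennreal_1 intro!: ennreal_leI)
    qed
    also have "\<dots> = ennreal (exp (- \<theta> * \<tau>)) * ennreal (pair_sum_mgf m \<theta> ^ card (edges n))"
      by (subst nn_integral_cmult, measurable, subst null_mgf_T_at[OF \<pi> \<theta>]) simp
    also have "\<dots> = ennreal ?b" by (simp add: ennreal_mult'' pair_sum_mgf_def)
    finally show ?thesis
      by (simp add: Q.emeasure_eq_measure pair_sum_mgf_def ennreal_le_iff)
  qed
  have "{X \<in> space ?Q. \<tau> \<le> T_max n m X}
      = (\<Union>\<pi>\<in>latent_tuples n m. {X \<in> space ?Q. \<tau> \<le> T_at n m \<pi> X})"
    by (auto simp: T_max_ge_iff)
  also have "measure ?Q \<dots> \<le> (\<Sum>\<pi>\<in>latent_tuples n m. measure ?Q {X \<in> space ?Q. \<tau> \<le> T_at n m \<pi> X})"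
    by (rule Q.finite_measure_subadditive_finite) (use T in auto)
  also have "\<dots> \<le> (\<Sum>\<pi>\<in>latent_tuples n m. ?b)" by (rule sum_mono) (rule chernoff)
  also have "\<dots> = fact n ^ (m - 1) * ?b" by (simp add: card_latent_tuples)
  finally show ?thesis .
qed

section \<open>Asymptotics of the null exponent\<close>

text \<open>The term \<open>- n\<close> is essential: after the cancellation of \<open>n ln n\<close> it is all that is left to make the
union bound effective.\<close>

lemma ln_fact_le:
  assumes "1 \<le> n"
  shows "ln (fact n) \<le> real n * ln (real n) - real n + ln (real n) + 1"
  using assms
proof (induction n rule: dec_induct)
  case base
  then show ?case by simp
next
  case (step n)
  have n: "0 < real n" using step by simp
  have "ln (real n / (real n + 1)) \<le> real n / (real n + 1) - 1"
    using n by (intro ln_le_minus_one) simp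
  also have "\<dots> = - 1 / (real n + 1)" using n by (simp add: field_simps)
  finally have "ln (real n) - ln (real n + 1) \<le> - 1 / (real n + 1)"
    using n by (simp add: ln_div)
  then have "(real n + 1) * (ln (real n) - ln (real n + 1)) \<le> (real n + 1) * (- 1 / (real n + 1))"
    by (rule mult_left_mono) (use n in simp)
  then have key: "(real n + 1) * ln (real n) + 1 \<le> (real n + 1) * ln (real n + 1)"
    using n by (simp add: algebra_simps)
  have "ln (fact (Suc n)) = ln (real n + 1) + ln (fact n)"
    using n by (simp add: ln_mult add.commute)
  with step.IH key show ?case by (simp add: algebra_simps)
qed

lemma neg_ln_one_minus_le:
  fixes x :: real
  assumes "0 \<le> x" "x \<le> 1 / 2"
  shows "- ln (1 - x) \<le> x + x\<^sup>2 / 2 + x ^ 3"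
proof -
  have "0 + 0\<^sup>2 / 2 + 0 ^ 3 + ln (1 - 0) \<le> x + x\<^sup>2 / 2 + x ^ 3 + ln (1 - x)"
  proof (rule DERIV_nonneg_imp_nondecreasing[OF assms(1)])
    fix y assume y: "0 \<le> y" "y \<le> x"
    then have p: "1 - y > 0" "y \<le> 1 / 2" using assms by auto
    have "((\<lambda>y. y + y\<^sup>2 / 2 + y ^ 3 + ln (1 - y)) has_real_derivative 1 + y + 3 * y\<^sup>2 - 1 / (1 - y)) (at y)"
      using p by (auto intro!: derivative_eq_intros simp: field_simps power2_eq_square)
    moreover have "0 \<le> 1 + y + 3 * y\<^sup>2 - 1 / (1 - y)"
    proof -
      have "1 + y + 3 * y\<^sup>2 - 1 / (1 - y) = y\<^sup>2 * (2 - 3 * y) / (1 - y)"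
        using p by (simp add: field_simps power2_eq_square)
      also have "\<dots> \<ge> 0" using p by (intro divide_nonneg_pos mult_nonneg_nonneg) auto
      finally show ?thesis .
    qed
    ultimately show "\<exists>d. ((\<lambda>y. y + y\<^sup>2 / 2 + y ^ 3 + ln (1 - y)) has_real_derivative d) (at y) \<and> 0 \<le> d"
      by blast
  qed
  then show ?thesis by simp
qed

lemma ln_one_plus_ge:
  fixes x :: real
  assumes "0 \<le> x"
  shows "x - x\<^sup>2 / 2 \<le> ln (1 + x)"
proof -
  have "ln (1 + 0) - 0 + 0\<^sup>2 / 2 \<le> ln (1 + x) - x + x\<^sup>2 / 2"
  proof (rule DERIV_nonneg_imp_nondecreasing[OF assms])
    fix y assume y: "0 \<le> y" "y \<le> x"
    have "((\<lambda>y. ln (1 + y) - y + y\<^sup>2 / 2) has_real_derivative 1 / (1 + y) - 1 + y) (at y)"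
      using y by (auto intro!: derivative_eq_intros simp: field_simps)
    moreover have "1 / (1 + y) - 1 + y = y\<^sup>2 / (1 + y)"
      using y by (simp add: field_simps power2_eq_square)
    then have "0 \<le> 1 / (1 + y) - 1 + y" using y by simp
    ultimately show "\<exists>d. ((\<lambda>y. ln (1 + y) - y + y\<^sup>2 / 2) has_real_derivative d) (at y) \<and> 0 \<le> d"
      by blast
  qed
  then show ?thesis by simp
qed

text \<open>The linear terms of the two logarithms cancel, as the pairwise product sum is centred, and the
quadratic terms add up to half its variance, which is \<open>m (m - 1) / 2\<close>, times \<open>\<theta>\<^sup>2\<close>.\<close>

lemma ln_pair_sum_mgf_le:
  assumes m: "1 \<le> m" and \<theta>: "0 \<le> \<theta>" "(real m - 1) * \<theta> \<le> 1 / 2"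
  shows "ln (pair_sum_mgf m \<theta>) \<le> real m * (real m - 1) / 4 * \<theta>\<^sup>2 + (real m - 1) ^ 3 * \<theta> ^ 3"
proof -
  define a where "a = real m - 1"
  have a: "0 \<le> a" "a * \<theta> \<le> 1 / 2" "real m = a + 1" using assms by (auto simp: a_def)
  have "ln (pair_sum_mgf m \<theta>) = - a / 2 * ln (1 + \<theta>) + (- ln (1 - a * \<theta>)) / 2"
    using a \<theta> by (simp add: pair_sum_mgf_def ln_mult a_def[symmetric] ln_powr)
  also have "\<dots> \<le> - a / 2 * (\<theta> - \<theta>\<^sup>2 / 2) + (a * \<theta> + (a * \<theta>)\<^sup>2 / 2 + (a * \<theta>) ^ 3) / 2"
  proof (intro add_mono divide_right_mono)
    show "- a / 2 * ln (1 + \<theta>) \<le> - a / 2 * (\<theta> - \<theta>\<^sup>2 / 2)"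
      by (rule mult_left_mono_neg[OF ln_one_plus_ge]) (use a \<theta> in auto)
    show "- ln (1 - a * \<theta>) \<le> a * \<theta> + (a * \<theta>)\<^sup>2 / 2 + (a * \<theta>) ^ 3"
      by (rule neg_ln_one_minus_le) (use a \<theta> in auto)
  qed simp
  also have "\<dots> = (a + 1) * a / 4 * \<theta>\<^sup>2 + a ^ 3 * \<theta> ^ 3 / 2"
    by (simp add: field_simps power2_eq_square power3_eq_cube)
  also have "\<dots> \<le> (a + 1) * a / 4 * \<theta>\<^sup>2 + a ^ 3 * \<theta> ^ 3"
    using a \<theta> by simp
  finally show ?thesis by (simp add: a a_def[symmetric])
qed

text \<open>At \<open>\<theta> = r\<close>, the smallest admissible correlation, the terms of order \<open>n ln n\<close> cancel exactly.  Replacing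
\<open>\<rho>\<close> by \<open>r\<close> in the product \<open>r * \<tau>\<close> only weakens the bound, so a single \<open>\<theta>\<close> serves all \<open>\<rho> \<ge> r\<close>.\<close>

lemma null_tail_bound_le:
  fixes n m :: nat and \<rho> r t :: real
  assumes m: "1 \<le> m" and n: "2 \<le> n"
    and r: "0 \<le> r" "r \<le> \<rho>" "(real m - 1) * r \<le> 1 / 2" "r\<^sup>2 = 8 / real m * (ln (real n) / (real n - 1))"
  defines "N \<equiv> card (edges n)"
  defines "\<tau> \<equiv> real N * (\<rho> * (real m * (real m - 1) / 2)) - t"
  shows "fact n ^ (m - 1) * (exp (- r * \<tau>) * pair_sum_mgf m r ^ N)
    \<le> exp ((real m - 1) * (- real n + ln (real n) + 1) + r * t + (real m - 1) ^ 3 * real N * r ^ 3)"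
proof -
  define a where "a = real m - 1"
  have a: "0 \<le> a" "real m = a + 1" "real (m - 1) = a" using m by (auto simp: a_def)
  have mgf: "0 < pair_sum_mgf m r"
    unfolding pair_sum_mgf_def using r by (intro mult_pos_pos) auto
  \<comment> \<open>The constant \<open>8 / m\<close> makes the quadratic term equal to the leading term of \<open>ln (fact n ^ (m - 1))\<close>.\<close>
  have Nr: "real N * r\<^sup>2 * (real m * a / 4) = a * (real n * ln (real n))"
    unfolding N_def card_edges r(4) using n m by (simp add: field_simps)
  have "real N * r * \<rho> \<ge> real N * r * r"
    using r by (intro mult_left_mono) auto
  then have "real N * r * \<rho> * (real m * a / 2) \<ge> real N * r * r * (real m * a / 2)"
    using a by (intro mult_right_mono) auto
  also have "real N * r * r * (real m * a / 2) = 2 * (a * (real n * ln (real n)))"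
    unfolding Nr[symmetric] by (simp add: power2_eq_square)
  finally have r\<tau>: "r * \<tau> \<ge> 2 * (a * (real n * ln (real n))) - r * t"
    unfolding \<tau>_def a_def[symmetric] by (simp add: algebra_simps)
  have "ln (fact n ^ (m - 1) * (exp (- r * \<tau>) * pair_sum_mgf m r ^ N))
      = a * ln (fact n) - r * \<tau> + real N * ln (pair_sum_mgf m r)"
    using mgf a(3) by (simp add: ln_mult ln_realpow)
  also have "\<dots> \<le> a * (real n * ln (real n) - real n + ln (real n) + 1)
      - (2 * (a * (real n * ln (real n))) - r * t)
      + real N * (real m * (real m - 1) / 4 * r\<^sup>2 + (real m - 1) ^ 3 * r ^ 3)"
    using a n m r by (intro add_mono diff_mono mult_left_mono ln_fact_le r\<tau> ln_pair_sum_mgf_le) auto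
  also have "real N * (real m * (real m - 1) / 4 * r\<^sup>2 + (real m - 1) ^ 3 * r ^ 3)
      = a * (real n * ln (real n)) + a ^ 3 * real N * r ^ 3"
    unfolding Nr[symmetric] a_def[symmetric] by (simp add: algebra_simps)
  also have "a * (real n * ln (real n) - real n + ln (real n) + 1)
      - (2 * (a * (real n * ln (real n))) - r * t) + (a * (real n * ln (real n)) + a ^ 3 * real N * r ^ 3)
      = a * (- real n + ln (real n) + 1) + r * t + a ^ 3 * real N * r ^ 3"
    by (simp add: algebra_simps)
  finally have "ln (fact n ^ (m - 1) * (exp (- r * \<tau>) * pair_sum_mgf m r ^ N))
      \<le> a * (- real n + ln (real n) + 1) + r * t + a ^ 3 * real N * r ^ 3" .
  then have "exp (ln (fact n ^ (m - 1) * (exp (- r * \<tau>) * pair_sum_mgf m r ^ N)))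
      \<le> exp (a * (- real n + ln (real n) + 1) + r * t + a ^ 3 * real N * r ^ 3)"
    by (simp only: exp_le_cancel_iff)
  then show ?thesis
    unfolding a_def[symmetric] using mgf by (subst (asm) exp_ln) simp_all
qed

text \<open>Divided by \<open>n\<close>, the exponent tends to \<open>- a\<close>.\<close>

lemma null_exponent_bound_tendsto_0:
  fixes a c :: real
  assumes a: "0 < a"
  shows "(\<lambda>n. exp (a * (- real n + ln (real n) + 1)
      + c * sqrt (ln (real n) / (real n - 1)) * real n powr (5 / 4)
      + a ^ 3 * (real n * (real n - 1) / 2) * (c * sqrt (ln (real n) / (real n - 1))) ^ 3))
    \<longlonglongrightarrow> 0"
proof -
  define s :: "nat \<Rightarrow> real" where "s n = sqrt (ln (real n) / (real n - 1))" for n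
  have l1: "(\<lambda>n. (- real n + ln (real n) + 1) / real n) \<longlonglongrightarrow> -1" by real_asymp
  have l2: "(\<lambda>n. s n * real n powr (5 / 4) / real n) \<longlonglongrightarrow> 0" unfolding s_def by real_asymp
  have l3: "(\<lambda>n. real n * (real n - 1) / 2 * s n ^ 3 / real n) \<longlonglongrightarrow> 0" unfolding s_def by real_asymp
  have "(\<lambda>n. a * ((- real n + ln (real n) + 1) / real n) + c * (s n * real n powr (5 / 4) / real n)
      + a ^ 3 * c ^ 3 * (real n * (real n - 1) / 2 * s n ^ 3 / real n)) \<longlonglongrightarrow> a * (-1) + c * 0 + a ^ 3 * c ^ 3 * 0"
    by (intro tendsto_intros l1 l2 l3)
  then have "(\<lambda>n. a * ((- real n + ln (real n) + 1) / real n) + c * (s n * real n powr (5 / 4) / real n)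
      + a ^ 3 * c ^ 3 * (real n * (real n - 1) / 2 * s n ^ 3 / real n)) \<longlonglongrightarrow> - a" by simp
  from filterlim_tendsto_neg_mult_at_bot[OF this _ filterlim_real_sequentially] a
  have "filterlim (\<lambda>n. (a * ((- real n + ln (real n) + 1) / real n) + c * (s n * real n powr (5 / 4) / real n)
      + a ^ 3 * c ^ 3 * (real n * (real n - 1) / 2 * s n ^ 3 / real n)) * real n) at_bot sequentially"
    by simp
  then have "filterlim (\<lambda>n. a * (- real n + ln (real n) + 1) + c * s n * real n powr (5 / 4)
      + a ^ 3 * (real n * (real n - 1) / 2) * (c * s n) ^ 3) at_bot sequentially"
  proof (rule filterlim_mono_eventually)
    show "\<forall>\<^sub>F n in sequentially. (a * ((- real n + ln (real n) + 1) / real n) + c * (s n * real n powr (5 / 4) / real n)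
      + a ^ 3 * c ^ 3 * (real n * (real n - 1) / 2 * s n ^ 3 / real n)) * real n
      = a * (- real n + ln (real n) + 1) + c * s n * real n powr (5 / 4)
      + a ^ 3 * (real n * (real n - 1) / 2) * (c * s n) ^ 3"
      using eventually_gt_at_top[of 0] by eventually_elim (simp add: field_simps power_mult_distrib)
  qed auto
  then show ?thesis
    unfolding s_def[symmetric] by (rule filterlim_compose[OF exp_at_bot])
qed

theorem theorem1:
  fixes m :: nat and \<rho> :: "nat \<Rightarrow> real"
  assumes "2 \<le> m"
    and "\<And>n. 0 \<le> \<rho> n \<and> \<rho> n < 1"
    and "\<forall>\<^sub>F n in sequentially. (\<rho> n)\<^sup>2 \<ge> 8 / real m * (ln (real n) / (real n - 1))"
  shows "\<exists>\<tau> :: nat \<Rightarrow> real.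
    (\<lambda>n. measure (planted_law n m (\<rho> n)) {X \<in> space (planted_law n m (\<rho> n)). T_max n m X < \<tau> n}
       + measure (null_law n m) {X \<in> space (null_law n m). T_max n m X \<ge> \<tau> n})
    \<longlonglongrightarrow> 0"
proof -
  \<comment> \<open>Any \<open>t\<close> between the orders \<open>n\<close> (planted fluctuations) and \<open>n * sqrt (n / ln n)\<close> (null slack) would do.\<close>
  define t :: "nat \<Rightarrow> real" where "t n = real n powr (5 / 4)" for n
  define r where "r n = sqrt (8 / real m) * sqrt (ln (real n) / (real n - 1))" for n
  define \<tau> where "\<tau> n = real (card (edges n)) * (\<rho> n * (real m * (real m - 1) / 2)) - t n" for n
  define P where "P n = measure (planted_law n m (\<rho> n)) {X \<in> space (planted_law n m (\<rho> n)). T_max n m X < \<tau> n}" for n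
  define Q where "Q n = measure (null_law n m) {X \<in> space (null_law n m). T_max n m X \<ge> \<tau> n}" for n
  have P: "P \<longlonglongrightarrow> 0"
  proof (rule tendsto_sandwich[OF always_eventually _ tendsto_const])
    show "\<forall>\<^sub>F n in sequentially. P n \<le> real n * (real n - 1) / 2 * (3 * real m ^ 4 / 4) / (t n)\<^sup>2"
      using eventually_gt_at_top[of 0]
    proof eventually_elim
      case (elim n)
      then have "0 < t n" by (simp add: t_def)
      with assms(2) show ?case
        unfolding P_def card_edges[symmetric]
        by (intro T_max_planted_lower_deviation) (auto simp: \<tau>_def less_imp_le)
    qed
    have "(\<lambda>n. real n * (real n - 1) / 2 / (t n)\<^sup>2) \<longlonglongrightarrow> 0" unfolding t_def by real_asymp
    from tendsto_mult_left[OF this, of "3 * real m ^ 4 / 4"]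
    show "(\<lambda>n. real n * (real n - 1) / 2 * (3 * real m ^ 4 / 4) / (t n)\<^sup>2) \<longlonglongrightarrow> 0"
      by (simp add: mult_ac)
  qed (simp add: P_def)
  have Q: "Q \<longlonglongrightarrow> 0"
  proof (rule tendsto_sandwich[OF always_eventually _ tendsto_const])
    have "(\<lambda>n. sqrt (ln (real n) / (real n - 1))) \<longlonglongrightarrow> 0" by real_asymp
    from tendsto_mult_left[OF this, of "(real m - 1) * sqrt (8 / real m)"]
    have "(\<lambda>n. (real m - 1) * r n) \<longlonglongrightarrow> 0" by (simp add: r_def mult_ac)
    then have "\<forall>\<^sub>F n in sequentially. (real m - 1) * r n < 1 / 2" by (rule order_tendstoD) simp
    then show "\<forall>\<^sub>F n in sequentially. Q n \<le> exp ((real m - 1) * (- real n + ln (real n) + 1)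
        + sqrt (8 / real m) * sqrt (ln (real n) / (real n - 1)) * real n powr (5 / 4)
        + (real m - 1) ^ 3 * (real n * (real n - 1) / 2) * (sqrt (8 / real m) * sqrt (ln (real n) / (real n - 1))) ^ 3)"
      using assms(3) eventually_ge_at_top[of 2]
    proof eventually_elim
      case (elim n)
      have q: "0 \<le> 8 / real m * (ln (real n) / (real n - 1))" using elim by simp
      have r0: "0 \<le> r n" using elim by (simp add: r_def)
      have r2: "(r n)\<^sup>2 = 8 / real m * (ln (real n) / (real n - 1))"
        using q elim by (simp add: r_def power_mult_distrib)
      have r\<rho>: "r n \<le> \<rho> n"
        by (rule power2_le_imp_le) (use r2 elim assms(2) in auto)
      have "Q n \<le> fact n ^ (m - 1) * (exp (- r n * \<tau> n) * pair_sum_mgf m (r n) ^ card (edges n))"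
        unfolding Q_def by (rule T_max_null_upper_tail) (use r0 elim in auto)
      also have "\<dots> \<le> exp ((real m - 1) * (- real n + ln (real n) + 1) + r n * t n
          + (real m - 1) ^ 3 * real (card (edges n)) * r n ^ 3)"
        unfolding \<tau>_def by (rule null_tail_bound_le) (use assms(1) elim r0 r\<rho> r2 in auto)
      finally show ?case by (simp only: card_edges r_def t_def)
    qed
    show "(\<lambda>n. exp ((real m - 1) * (- real n + ln (real n) + 1)
        + sqrt (8 / real m) * sqrt (ln (real n) / (real n - 1)) * real n powr (5 / 4)
        + (real m - 1) ^ 3 * (real n * (real n - 1) / 2) * (sqrt (8 / real m) * sqrt (ln (real n) / (real n - 1))) ^ 3)) \<longlonglongrightarrow> 0"
      by (rule null_exponent_bound_tendsto_0) (use assms(1) in simp)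
  qed (simp add: Q_def)
  have "(\<lambda>n. P n + Q n) \<longlonglongrightarrow> 0" using tendsto_add[OF P Q] by simp
  then show ?thesis unfolding P_def Q_def by (intro exI[of _ \<tau>])
qed

end
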